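(* Let $\mu:[0,\infty)\to[0,\infty)$ be a smooth function satisfying $$\mu(I)+2\min\Big\{\frac{d\mu(I)}{dI},\,0\Big\}\,I\ \ge\ 0\qquad\text{for all } I\ge 0 .$$ Let $(f_i^{(n)})_{0\le i\le 8,\ n\ge 0}$ be smooth functions of $(x,t)$, spatially periodic in $x\in\mathbb{R}^2$, $t\in[0,T]$, with $f_i^{(0)}=w_i$, which are the coefficients of a formal expansion $f_i\sim\sum_{n\ge0}h^nf_i^{(n)}$ solving, to all orders in $h$, the D2Q9 lattice Boltzmann equation with time step $h^2$ and either the first collision term (shear-dependent relaxation time, hierarchy (I) of the context) or the second collision term (constant relaxation time $\tau>0$, hierarchy (II) of the context). Put $\rho^{(n)}=\sum_{i}f_i^{(n)}$ and $v^{(n)}=\sum_i c_if_i^{(n)}$, and assume that for all $k=0,1,2,\dots$ $$\rho^{(2k+1)}\big|_{t=0}=0,\qquad v^{(2k)}\big|_{t=0}=0 .$$ Then, for both collision terms, for all $k\ge 0$ and all $i\in\{0,\dots,8\}$, $$f_i^{(k)}=(-1)^k f_{\bar i}^{(k)}$$ on the whole space-time domain.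
   Context: **D2Q9 lattice.** $c_0=(0,0)$; $c_1,\dots,c_4=(1,0),(0,1),(-1,0),(0,-1)$; $c_5,\dots,c_8=(1,1),(-1,1),(-1,-1),(1,-1)$. Weights: $w_0=\tfrac{16}{36}$, $w_1=\dots=w_4=\tfrac{4}{36}$, $w_5=\dots=w_8=\tfrac1{36}$. The involution $i\mapsto\bar i$ is $\bar 0=0$, $\bar1=3,\bar2=4,\bar3=1,\bar4=2$, $\bar5=7,\bar6=8,\bar7=5,\bar8=6$, so $c_{\bar i}=-c_i$. **Lattice Boltzmann equation.** $f_i(x+c_ih,t+h^2)-f_i(x,t)=\Omega_i(x,t)$, $i=0,\dots,8$, with lattice spacing $h$. Write $\rho=\sum_if_i$, $v=\sum_ic_if_i$, $S=\nabla v+(\nabla v)^t$, $$f_{iL}(\rho,v)=w_i(\rho+3c_i\cdot v),\qquad f_{iQ}(u,v)=w_i\big[\tfrac92(c_i\cdot u)(c_i\cdot v)-\tfrac32u\cdot v\big].$$ For symmetric matrices $S:M=\sum_{a,b}S_{ab}M_{ab}$; $c_i^tc_i$ is the $2\times2$ matrix with entries $(c_i)_a(c_i)_b$. First collision term: $\Omega_i=\frac{1}{\tau(S/h)}\big(f_{iL}(\rho,v)+f_{iQ}(v,v)-f_i\big)$ with $\tau(S)=3\mu(\mathrm{tr}(S^2))+\tfrac12$. Second collision term: $\Omega_i=\frac1\tau\big(f_{iL}(\rho,v)+f_{iQ}(v,v)+w_i\,h\,A(S/h)\,S:c_i^tc_i-f_i\big)$ with constant $\tau>0$ and $A(S)=\tfrac32(\tau-\tfrac12)-\tfrac92\mu(\mathrm{tr}(S^2))$.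 **Formal expansion.** Set $\rho^{(n)}=\sum_if_i^{(n)}$, $v^{(n)}=\sum_ic_if_i^{(n)}$, $S^{(n)}=\nabla v^{(n)}+(\nabla v^{(n)})^t$. Since $f_i^{(0)}=w_i$, one has $\rho^{(0)}=1$, $v^{(0)}=0$, $S^{(0)}=0$. Let $S_h/h$ denote the formal series $S^{(1)}+hS^{(2)}+h^2S^{(3)}+\cdots$, and define $F^{(n)}$, $A^{(n)}$ as the coefficients of the formal Taylor expansions in $h$: $\tau(S_h/h)\sim\sum_{n\ge0}h^nF^{(n)}$ (first model), $A(S_h/h)\sim\sum_{n\ge0}h^nA^{(n)}$ (second model). Let $$D_{i,s}=\sum_{l+2m=s,\ l,m\ge0}\frac{1}{l!\,m!}\,\partial_t^m(c_i\cdot\nabla)^l\qquad(s\ge1).$$ Solving the lattice Boltzmann equation to all orders means that, after Taylor expansion of the left-hand side and comparison of powers of $h$, for every $k\ge0$ and every $i$: (I) first model: $$\sum_{r+n=k,\ r\ge0,\ n\ge1}F^{(r)}\sum_{s=1}^{n}D_{i,s}f_i^{(n-s)}=-f_i^{(k)}+f_{iL}(\rho^{(k)},v^{(k)})+\sum_{p+q=k}f_{iQ}(v^{(p)},v^{(q)});$$ (II) second model: $$\tau\sum_{s=1}^{k}D_{i,s}f_i^{(k-s)}=-f_i^{(k)}+f_{iL}(\rho^{(k)},v^{(k)})+\sum_{p+q=k}f_{iQ}(v^{(p)},v^{(q)})+\sum_{a+b=k-1,\ a,b\ge 0}w_i\,A^{(a)}S^{(b)}:c_i^tc_i\,$$ (the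 last summand is written with the indices arising from expanding $h\,A(S_h/h)\,S_h$ where $S_h\sim\sum_{n\ge0}h^nS^{(n)}$; empty sums are $0$). *)

theory Defs
  imports "HOL-Analysis.Analysis" "HOL-Computational_Algebra.Formal_Power_Series"
begin

section \<open>Smooth functions on closed domains\<close>

text \<open>Derivatives are taken within \<open>D\<close>, hence are one-sided at the boundary. They are used only for
  \<open>D = {0..}\<close> and \<open>D = UNIV \<times> {0..T}\<close> with \<open>T > 0\<close>; these are convex with nonempty interior, so the
  Frechet derivative within \<open>D\<close> is unique and depends only on the values on \<open>D\<close>.\<close>

definition dir_deriv ::
    "'a::real_normed_vector set \<Rightarrow> 'a \<Rightarrow> ('a \<Rightarrow> real) \<Rightarrow> 'a \<Rightarrow> real"
  where "dir_deriv D e g = (\<lambda>p. frechet_derivative g (at p within D) e)"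

primrec C_k_on :: "nat \<Rightarrow> 'a::real_normed_vector set \<Rightarrow> ('a \<Rightarrow> real) \<Rightarrow> bool"
  where
    "C_k_on 0 D g \<longleftrightarrow> continuous_on D g"
  | "C_k_on (Suc k) D g \<longleftrightarrow> g differentiable_on D \<and> (\<forall>e. C_k_on k D (dir_deriv D e g))"

definition smooth_on :: "'a::real_normed_vector set \<Rightarrow> ('a \<Rightarrow> real) \<Rightarrow> bool"
  where "smooth_on D g \<longleftrightarrow> (\<forall>k. C_k_on k D g)"


section \<open>The D2Q9 lattice\<close>

text \<open>Lattice directions are the naturals \<open>0, \<dots>, 8\<close>; the lists below are never indexed beyond.\<close>

definition vel :: "nat \<Rightarrow> real^2"
  where "vel i =
    [vector [0, 0],
     vector [1, 0], vector [0, 1], vector [-1, 0], vector [0, -1],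
     vector [1, 1], vector [-1, 1], vector [-1, -1], vector [1, -1]] ! i"

definition weight :: "nat \<Rightarrow> real"
  where "weight i = [16/36, 4/36, 4/36, 4/36, 4/36, 1/36, 1/36, 1/36, 1/36] ! i"

definition opp :: "nat \<Rightarrow> nat"
  where "opp i = [0, 3, 4, 1, 2, 7, 8, 5, 6] ! i"

lemma vel_opp: "i \<le> 8 \<Longrightarrow> vel (opp i) = - vel i"
  by (auto simp: vel_def opp_def le_Suc_eq numeral_eq_Suc vec_eq_iff forall_2 vector_2)

definition f_lin :: "nat \<Rightarrow> real \<Rightarrow> real^2 \<Rightarrow> real"
  where "f_lin i \<rho> v = weight i * (\<rho> + 3 * (vel i \<bullet> v))"

definition f_quad :: "nat \<Rightarrow> real^2 \<Rightarrow> real^2 \<Rightarrow> real"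
  where "f_quad i u v = weight i * (9/2 * (vel i \<bullet> u) * (vel i \<bullet> v) - 3/2 * (u \<bullet> v))"

definition contract :: "real^2^2 \<Rightarrow> real^2^2 \<Rightarrow> real"
  where "contract S M = (\<Sum>a\<in>UNIV. \<Sum>b\<in>UNIV. S $ a $ b * M $ a $ b)"

definition vel_tensor :: "nat \<Rightarrow> real^2^2"
  where "vel_tensor i = (\<chi> a b. vel i $ a * vel i $ b)"


section \<open>Differential operators on space-time\<close>

definition slab :: "real \<Rightarrow> ((real^2) \<times> real) set"
  where "slab T = UNIV \<times> {0..T}"

definition d_space :: "real \<Rightarrow> 2 \<Rightarrow> ((real^2) \<times> real \<Rightarrow> real) \<Rightarrow> (real^2) \<times> real \<Rightarrow> real"
  where "d_space T a = dir_deriv (slab T) (axis a 1, 0)"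

definition d_time :: "real \<Rightarrow> ((real^2) \<times> real \<Rightarrow> real) \<Rightarrow> (real^2) \<times> real \<Rightarrow> real"
  where "d_time T = dir_deriv (slab T) (0, 1)"

definition advect :: "real \<Rightarrow> real^2 \<Rightarrow> ((real^2) \<times> real \<Rightarrow> real) \<Rightarrow> (real^2) \<times> real \<Rightarrow> real"
  where "advect T c g = (\<lambda>p. \<Sum>a\<in>UNIV. c $ a * d_space T a g p)"

text \<open>The coefficient of \<open>h^s\<close> in the Taylor expansion of \<open>g (x + h c\<^sub>i, t + h\<^sup>2)\<close>.\<close>

definition D_op ::
    "real \<Rightarrow> nat \<Rightarrow> nat \<Rightarrow> ((real^2) \<times> real \<Rightarrow> real) \<Rightarrow> (real^2) \<times> real \<Rightarrow> real"
  where "D_op T i s g = (\<lambda>p. \<Sum>(l, m)\<in>{(l, m). l + 2 * m = s}.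
    1 / (fact l * fact m) * (d_time T ^^ m) ((advect T (vel i) ^^ l) g) p)"

definition periodic_in_space :: "real \<Rightarrow> real^2 \<Rightarrow> ((real^2) \<times> real \<Rightarrow> real) \<Rightarrow> bool"
  where "periodic_in_space T L g \<longleftrightarrow>
    (\<forall>a x. \<forall>t\<in>{0..T}. g (x + axis a (L $ a), t) = g (x, t))"


section \<open>Formal expansions\<close>

text \<open>A coefficient family has type \<open>nat \<Rightarrow> nat \<Rightarrow> (real^2) \<times> real \<Rightarrow> real\<close>: \<open>f n i (x, t)\<close> is the
  coefficient of \<open>h^n\<close> in direction \<open>i\<close>.\<close>

type_synonym family = "nat \<Rightarrow> nat \<Rightarrow> (real^2) \<times> real \<Rightarrow> real"

definition rho :: "family \<Rightarrow> nat \<Rightarrow> (real^2) \<times> real \<Rightarrow> real"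
  where "rho f n p = (\<Sum>i\<le>8. f n i p)"

definition mom :: "family \<Rightarrow> nat \<Rightarrow> (real^2) \<times> real \<Rightarrow> real^2"
  where "mom f n p = (\<Sum>i\<le>8. f n i p *\<^sub>R vel i)"

definition grad :: "real \<Rightarrow> ((real^2) \<times> real \<Rightarrow> real^2) \<Rightarrow> (real^2) \<times> real \<Rightarrow> real^2^2"
  where "grad T v p = (\<chi> a b. d_space T a (\<lambda>q. v q $ b) p)"

definition strain :: "real \<Rightarrow> family \<Rightarrow> nat \<Rightarrow> (real^2) \<times> real \<Rightarrow> real^2^2"
  where "strain T f n p = grad T (mom f n) p + transpose (grad T (mom f n) p)"

text \<open>The formal series \<open>S\<^sub>h/h = S\<^bsup>(1)\<^esup> + h S\<^bsup>(2)\<^esup> + \<dots>\<close> at a point, as a matrix of formal power series.\<close>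

definition strain_series :: "real \<Rightarrow> family \<Rightarrow> (real^2) \<times> real \<Rightarrow> real fps^2^2"
  where "strain_series T f p = (\<chi> a b. Abs_fps (\<lambda>n. strain T f (Suc n) p $ a $ b))"

text \<open>The formal Taylor expansion of \<open>\<mu>\<close> of a formal series \<open>G\<close>, namely
  \<open>\<Sum>j. \<mu>\<^bsup>(j)\<^esup>(G\<^sub>0) / j! * (G - G\<^sub>0)^j\<close> with \<open>G\<^sub>0\<close> the constant term of \<open>G\<close>. In the
  applications \<open>G\<^sub>0\<close> is the trace of the square of a symmetric matrix, so \<open>G\<^sub>0 \<ge> 0\<close>.\<close>

definition formal_taylor :: "(real \<Rightarrow> real) \<Rightarrow> real fps \<Rightarrow> real fps"
  where "formal_taylor \<mu> G =
    Abs_fps (\<lambda>j. (dir_deriv {0..} 1 ^^ j) \<mu> (fps_nth G 0) / fact j)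
      oo (G - fps_const (fps_nth G 0))"

definition mu_series ::
    "(real \<Rightarrow> real) \<Rightarrow> real \<Rightarrow> family \<Rightarrow> (real^2) \<times> real \<Rightarrow> real fps"
  where "mu_series \<mu> T f p =
    formal_taylor \<mu> (trace (strain_series T f p ** strain_series T f p))"

text \<open>\<open>F\<^bsup>(n)\<^esup>\<close>: coefficients of \<open>\<tau>(S\<^sub>h/h)\<close> for \<open>\<tau>(S) = 3 \<mu>(tr(S\<^sup>2)) + 1/2\<close>.\<close>

definition F_coeff ::
    "(real \<Rightarrow> real) \<Rightarrow> real \<Rightarrow> family \<Rightarrow> nat \<Rightarrow> (real^2) \<times> real \<Rightarrow> real"
  where "F_coeff \<mu> T f n p =
    fps_nth (fps_const 3 * mu_series \<mu> T f p + fps_const (1/2)) n"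

text \<open>\<open>A\<^bsup>(n)\<^esup>\<close>: coefficients of \<open>A(S\<^sub>h/h)\<close> for \<open>A(S) = 3/2 (\<tau> - 1/2) - 9/2 \<mu>(tr(S\<^sup>2))\<close>.\<close>

definition A_coeff ::
    "(real \<Rightarrow> real) \<Rightarrow> real \<Rightarrow> real \<Rightarrow> family \<Rightarrow> nat \<Rightarrow> (real^2) \<times> real \<Rightarrow> real"
  where "A_coeff \<mu> \<tau> T f n p =
    fps_nth (fps_const (3/2 * (\<tau> - 1/2)) - fps_const (9/2) * mu_series \<mu> T f p) n"

definition solves_first_model :: "(real \<Rightarrow> real) \<Rightarrow> real \<Rightarrow> family \<Rightarrow> bool"
  where "solves_first_model \<mu> T f \<longleftrightarrow>
    (\<forall>k. \<forall>i\<le>8. \<forall>z\<in>slab T.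
      (\<Sum>(r, n)\<in>{(r, n). r + n = k \<and> 1 \<le> n}.
         F_coeff \<mu> T f r z * (\<Sum>s=1..n. D_op T i s (f (n - s) i) z))
      = - f k i z + f_lin i (rho f k z) (mom f k z)
        + (\<Sum>(p, q)\<in>{(p, q). p + q = k}. f_quad i (mom f p z) (mom f q z)))"

definition solves_second_model :: "(real \<Rightarrow> real) \<Rightarrow> real \<Rightarrow> real \<Rightarrow> family \<Rightarrow> bool"
  where "solves_second_model \<mu> \<tau> T f \<longleftrightarrow>
    (\<forall>k. \<forall>i\<le>8. \<forall>z\<in>slab T.
      \<tau> * (\<Sum>s=1..k. D_op T i s (f (k - s) i) z)
      = - f k i z + f_lin i (rho f k z) (mom f k z)
        + (\<Sum>(p, q)\<in>{(p, q). p + q = k}. f_quad i (mom f p z) (mom f q z))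
        + (\<Sum>(a, b)\<in>{(a, b). a + b + 1 = k}.
             weight i * A_coeff \<mu> \<tau> T f a z * contract (strain T f b z) (vel_tensor i)))"

end

(* The hierarchy is invariant under reversing the velocities together with h \<rightarrow> -h, so the theorem is the
   uniqueness of formal expansions with given hydrodynamic initial data. Going up in the order k, the
   equation of order k shows that the part of f^(k) of the wrong parity is w_i \<rho>^(k) for odd k and
   3 w_i c_i . v^(k) for even k. For odd k, the momentum balance gives \<nabla>\<rho>^(k) = 0, and the mass balance,
   integrated over a period cell, gives \<partial>_t \<rho>^(k) = 0 and div v^(k+1) = 0. For even k, v^(k) solves the
   Navier-Stokes equations linearised at v^(1), with viscous stress
   \<mu>(|S1|^2) Sk + 2 \<mu>'(|S1|^2) (S1:Sk) S1. By Cauchy-Schwarz the hypothesis on \<mu> makes it dissipative, and an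
   energy estimate with Gronwall's lemma gives v^(k) = 0. *)
theory Submission
  imports Defs
begin

text \<open>Each order is settled by equations of higher order. Space derivatives cost one power of
  h and time derivatives two, so \<open>rho f k\<close> and \<open>mom f k\<close> are governed by
  the balances of orders k+1 and k+2. These also contain \<open>f (k + 1)\<close>, whose parity is
  still open; only its divergence or its second moments enter. The obstacle is that the coefficients
  of \<tau> and A reach ahead: the one of index n contains the strain of order n+1. In the equation
  of order k the factor multiplying the open strain vanishes because \<open>f 0\<close> is constant;
  at order k+1 it survives and produces the term with the derivative of \<mu>. An odd coefficient of
  the series of \<mu> is linear in the first open strain, so the viscous stress is the derivative of
  S -> \<mu>(S:S) S at the leading strain, and the hypothesis on \<mu> says exactly that this
  derivative is positive semidefinite.\<close>

section \<open>Calculus on the space-time slab\<close>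

lemma dir_deriv_cong:
  assumes "p \<in> D" "\<And>q. q \<in> D \<Longrightarrow> g q = g' q"
  shows "dir_deriv D e g p = dir_deriv D e g' p"
proof -
  have "(g has_derivative d) (at p within D) \<longleftrightarrow> (g' has_derivative d) (at p within D)" for d
    using assms by (metis has_derivative_transform)
  then show ?thesis
    by (simp add: dir_deriv_def frechet_derivative_def)
qed

lemma differentiable_on_cong:
  assumes "\<And>q. q \<in> D \<Longrightarrow> g q = g' q" "g differentiable_on D"
  shows "g' differentiable_on D"
  using assms unfolding differentiable_on_def differentiable_def
  by (metis has_derivative_transform)

lemma C_k_on_cong:
  assumes "\<And>q. q \<in> D \<Longrightarrow> g q = g' q" "C_k_on k D g"
  shows "C_k_on k D g'"
  using assms
proof (induction k arbitrary: g g')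
  case 0
  then show ?case by (simp cong: continuous_on_cong)
next
  case (Suc k)
  have "C_k_on k D (dir_deriv D e g')" for e
    using Suc.IH[of "dir_deriv D e g" "dir_deriv D e g'"] Suc.prems dir_deriv_cong[of _ D g g' e]
    by auto
  then show ?case
    using Suc.prems differentiable_on_cong[of D g g'] by auto
qed

lemma C_k_on_Suc_imp: "C_k_on (Suc k) D g \<Longrightarrow> C_k_on k D g"
proof (induction k arbitrary: g)
  case 0
  then show ?case by (simp add: differentiable_imp_continuous_on)
next
  case (Suc k)
  then show ?case by (metis C_k_on.simps(2))
qed

lemma smooth_on_differentiable: "smooth_on D g \<Longrightarrow> g differentiable_on D"
  unfolding smooth_on_def by (metis C_k_on.simps(2))

lemma smooth_on_continuous: "smooth_on D g \<Longrightarrow> continuous_on D g"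
  unfolding smooth_on_def by (metis C_k_on.simps(1))

lemma smooth_on_dir_deriv: "smooth_on D g \<Longrightarrow> smooth_on D (dir_deriv D e g)"
  unfolding smooth_on_def by (metis C_k_on.simps(2))

lemma dir_deriv_works:
  assumes "g differentiable_on D" "p \<in> D"
  shows "(g has_derivative (\<lambda>e. dir_deriv D e g p)) (at p within D)"
  using assms unfolding dir_deriv_def differentiable_on_def
  by (simp add: frechet_derivative_works eta_contract_eq)

lemma slab_iff: "(x, t) \<in> slab T \<longleftrightarrow> 0 \<le> t \<and> t \<le> T"
  by (auto simp: slab_def)

locale spacetime =
  fixes T :: real
  assumes T_pos: "0 < T"
begin

abbreviation "D \<equiv> slab T"
abbreviation "dd \<equiv> dir_deriv (slab T)"
abbreviation "sm \<equiv> smooth_on (slab T)"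

text \<open>\<open>frechet_derivative\<close> is a choice; it becomes computable because derivatives
  within \<open>D\<close> are unique as soon as each axis direction can be followed inside
  \<open>D\<close> by arbitrarily small steps.\<close>

lemma dir_deriv_eq:
  assumes "(g has_derivative g') (at p within D)" "p \<in> D"
  shows "dd e g p = g' e"
proof -
  obtain x t where p: "p = (x, t)" by force
  with assms have t: "0 \<le> t" "t \<le> T" by (auto simp: slab_iff)
  have "frechet_derivative g (at p within D) = g'"
  proof (rule frechet_derivative_unique_within)
    show "(g has_derivative frechet_derivative g (at p within D)) (at p within D)"
      using assms by (metis differentiableI frechet_derivative_works)
    show "(g has_derivative g') (at p within D)" by fact
    fix i :: "(real^2) \<times> real" and r :: real
    assume i: "i \<in> Basis" and r: "r > 0"
    \<comment> \<open>Forward in time, except on the final time slice, where the step goes backward;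
      \<open>T_pos\<close> keeps it nonzero. It also serves the space directions, in which the slab
      is unbounded.\<close>
    define d where "d = (if t < T then min (r/2) (T - t) else - min (r/2) T)"
    have d: "0 < \<bar>d\<bar>" "\<bar>d\<bar> < r" "0 \<le> t + d" "t + d \<le> T"
      using t r T_pos by (auto simp: d_def min_def)
    from i have "snd i = 0 \<or> snd i = 1"
      by (auto simp: Basis_prod_def)
    with d p t show "\<exists>d. 0 < \<bar>d\<bar> \<and> \<bar>d\<bar> < r \<and> p + d *\<^sub>R i \<in> D"
      by (intro exI[of _ d]) (auto simp: slab_def mem_Times_iff)
  qed
  then show ?thesis by (simp add: dir_deriv_def)
qed

lemma dd_const: "p \<in> D \<Longrightarrow> dd e (\<lambda>p. c) p = 0"
  using dir_deriv_eq[OF has_derivative_const] .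

lemma dd_add:
  assumes "g differentiable_on D" "h differentiable_on D" "p \<in> D"
  shows "dd e (\<lambda>p. g p + h p) p = dd e g p + dd e h p"
  using dir_deriv_eq[OF has_derivative_add[OF dir_deriv_works[OF assms(1,3)] dir_deriv_works[OF assms(2,3)]] assms(3)] .

lemma dd_mult:
  assumes "g differentiable_on D" "h differentiable_on D" "p \<in> D"
  shows "dd e (\<lambda>p. g p * h p) p = g p * dd e h p + dd e g p * h p"
  using dir_deriv_eq[OF has_derivative_mult[OF dir_deriv_works[OF assms(1,3)] dir_deriv_works[OF assms(2,3)]] assms(3)] .

lemma dd_sum:
  assumes "\<And>i. i \<in> I \<Longrightarrow> g i differentiable_on D" "p \<in> D"
  shows "dd e (\<lambda>p. \<Sum>i\<in>I. c i * g i p) p = (\<Sum>i\<in>I. c i * dd e (g i) p)"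
proof -
  have "((\<lambda>p. \<Sum>i\<in>I. c i * g i p) has_derivative (\<lambda>e. \<Sum>i\<in>I. c i * dd e (g i) p)) (at p within D)"
    by (intro has_derivative_sum has_derivative_mult_right dir_deriv_works assms)
  then show ?thesis using assms(2) by (rule dir_deriv_eq)
qed

lemma C_k_on_const: "C_k_on k D (\<lambda>p. c)"
proof (induction k arbitrary: c)
  case (Suc k)
  have "C_k_on k D (dd e (\<lambda>p. c))" for e
    by (rule C_k_on_cong[OF _ Suc.IH[of 0]]) (simp add: dd_const)
  then show ?case by simp
qed simp

lemma C_k_on_add: "C_k_on k D g \<Longrightarrow> C_k_on k D h \<Longrightarrow> C_k_on k D (\<lambda>p. g p + h p)"
proof (induction k arbitrary: g h)
  case (Suc k)
  have "C_k_on k D (dd e (\<lambda>p. g p + h p))" for e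
    by (rule C_k_on_cong[OF _ Suc.IH[of "dd e g" "dd e h"]]) (use Suc.prems in \<open>simp_all add: dd_add del: split_paired_All\<close>)
  then show ?case using Suc.prems by simp
qed (simp add: continuous_on_add)

text \<open>The product rule leaves undifferentiated factors, so the induction also needs
  \<open>g\<close> and \<open>h\<close> themselves at level \<open>k\<close>;
  \<open>C_k_on_Suc_imp\<close> supplies this.\<close>

lemma C_k_on_mult: "C_k_on k D g \<Longrightarrow> C_k_on k D h \<Longrightarrow> C_k_on k D (\<lambda>p. g p * h p)"
proof (induction k arbitrary: g h)
  case (Suc k)
  have *: "C_k_on k D g" "C_k_on k D h"
    using Suc.prems C_k_on_Suc_imp by blast+
  have "C_k_on k D (dd e (\<lambda>p. g p * h p))" for e
    by (rule C_k_on_cong[OF _ C_k_on_add[OF Suc.IH[of g "dd e h"] Suc.IH[of "dd e g" h]]])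
      (use Suc.prems * in \<open>simp_all add: dd_mult del: split_paired_All\<close>)
  then show ?case using Suc.prems by simp
qed (simp add: continuous_on_mult)

lemma sm_const: "sm (\<lambda>p. c)"
  by (simp add: smooth_on_def C_k_on_const)

lemma sm_add: "sm g \<Longrightarrow> sm h \<Longrightarrow> sm (\<lambda>p. g p + h p)"
  by (simp add: smooth_on_def C_k_on_add)

lemma sm_mult: "sm g \<Longrightarrow> sm h \<Longrightarrow> sm (\<lambda>p. g p * h p)"
  by (simp add: smooth_on_def C_k_on_mult)

lemma sm_sum: "(\<And>i. i \<in> I \<Longrightarrow> sm (g i)) \<Longrightarrow> sm (\<lambda>p. \<Sum>i\<in>I. g i p)"
  by (induction I rule: infinite_finite_induct) (auto intro: sm_add sm_const)

lemma sm_d_space: "sm g \<Longrightarrow> sm (d_space T a g)"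
  by (simp add: d_space_def smooth_on_dir_deriv)

lemma sm_d_time: "sm g \<Longrightarrow> sm (d_time T g)"
  by (simp add: d_time_def smooth_on_dir_deriv)

lemma sm_advect: "sm g \<Longrightarrow> sm (advect T c g)"
  unfolding advect_def by (intro sm_sum sm_mult sm_const sm_d_space)

lemmas sm_intros = sm_const sm_add sm_mult sm_sum sm_d_space sm_d_time sm_advect

lemma d_space_const: "z \<in> D \<Longrightarrow> d_space T a (\<lambda>p. c) z = 0"
  and d_time_const: "z \<in> D \<Longrightarrow> d_time T (\<lambda>p. c) z = 0"
  by (simp_all add: d_space_def d_time_def dd_const)

lemma d_space_add: "\<lbrakk>sm g; sm h; z \<in> D\<rbrakk> \<Longrightarrow>
    d_space T a (\<lambda>p. g p + h p) z = d_space T a g z + d_space T a h z"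
  and d_time_add: "\<lbrakk>sm g; sm h; z \<in> D\<rbrakk> \<Longrightarrow>
    d_time T (\<lambda>p. g p + h p) z = d_time T g z + d_time T h z"
  by (simp_all add: d_space_def d_time_def dd_add smooth_on_differentiable)

lemma d_space_mult: "\<lbrakk>sm g; sm h; z \<in> D\<rbrakk> \<Longrightarrow>
    d_space T a (\<lambda>p. g p * h p) z = g z * d_space T a h z + d_space T a g z * h z"
  and d_time_mult: "\<lbrakk>sm g; sm h; z \<in> D\<rbrakk> \<Longrightarrow>
    d_time T (\<lambda>p. g p * h p) z = g z * d_time T h z + d_time T g z * h z"
  by (simp_all add: d_space_def d_time_def dd_mult smooth_on_differentiable)

lemma d_space_sum: "\<lbrakk>\<And>i. i \<in> I \<Longrightarrow> sm (g i); z \<in> D\<rbrakk> \<Longrightarrow>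
    d_space T a (\<lambda>p. \<Sum>i\<in>I. c i * g i p) z = (\<Sum>i\<in>I. c i * d_space T a (g i) z)"
  and d_time_sum: "\<lbrakk>\<And>i. i \<in> I \<Longrightarrow> sm (g i); z \<in> D\<rbrakk> \<Longrightarrow>
    d_time T (\<lambda>p. \<Sum>i\<in>I. c i * g i p) z = (\<Sum>i\<in>I. c i * d_time T (g i) z)"
  unfolding d_space_def d_time_def by (rule dd_sum; simp add: smooth_on_differentiable)+

lemma d_space_cong: "\<lbrakk>\<And>q. q \<in> D \<Longrightarrow> g q = h q; z \<in> D\<rbrakk> \<Longrightarrow> d_space T a g z = d_space T a h z"
  and d_time_cong: "\<lbrakk>\<And>q. q \<in> D \<Longrightarrow> g q = h q; z \<in> D\<rbrakk> \<Longrightarrow> d_time T g z = d_time T h z"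
  unfolding d_space_def d_time_def by (rule dir_deriv_cong; simp)+

text \<open>Space translations preserve the slab. This makes derivatives of periodic functions
  periodic, and later makes the time derivative of a spatially constant density spatially
  constant.\<close>

lemma dd_translate:
  assumes "sm g" "(x, t) \<in> D"
  shows "dd e (\<lambda>p. g (p + (y, 0))) (x, t) = dd e g (x + y, t)"
proof -
  have D: "(x + y, t) \<in> D" using assms by (simp add: slab_iff)
  have im: "(\<lambda>p. p + (y, 0)) ` D \<subseteq> D" by (auto simp: slab_def)
  have "(g has_derivative (\<lambda>e. dd e g (x + y, t))) (at ((x, t) + (y, 0)) within D)"
    using dir_deriv_works[OF smooth_on_differentiable[OF assms(1)] D] by simp
  then have "(g has_derivative (\<lambda>e. dd e g (x + y, t))) (at ((x, t) + (y, 0)) within (\<lambda>p. p + (y, 0)) ` D)"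
    using im by (rule has_derivative_subset)
  moreover have "((\<lambda>p. p + (y, 0)) has_derivative (\<lambda>e. e)) (at (x, t) within D)"
    by (auto intro!: derivative_eq_intros)
  ultimately have "((\<lambda>p. g (p + (y, 0))) has_derivative (\<lambda>e. dd e g (x + y, t))) (at (x, t) within D)"
    using has_derivative_in_compose by blast
  then show ?thesis by (rule dir_deriv_eq) fact
qed

lemma periodic_dd:
  assumes "sm g" "periodic_in_space T L g"
  shows "periodic_in_space T L (dd e g)"
  unfolding periodic_in_space_def
proof (intro allI ballI)
  fix a x t assume t: "t \<in> {0..T}"
  have "dd e g (x + axis a (L $ a), t) = dd e (\<lambda>p. g (p + (axis a (L $ a), 0))) (x, t)"
    using t by (simp add: dd_translate[OF assms(1)] slab_iff)
  also have "\<dots> = dd e g (x, t)"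
    using t assms(2) by (intro dir_deriv_cong) (auto simp: slab_def periodic_in_space_def)
  finally show "dd e g (x + axis a (L $ a), t) = dd e g (x, t)" .
qed

lemma has_vector_derivative_space:
  assumes "sm g" "t \<in> {0..T}"
  shows "((\<lambda>s. g (x + s *\<^sub>R axis a 1, t)) has_vector_derivative d_space T a g (x + s *\<^sub>R axis a 1, t))
    (at s)"
proof -
  let ?l = "\<lambda>s. (x + s *\<^sub>R axis a 1, t)"
  have D: "?l s \<in> D" for s using assms(2) by (simp add: slab_iff)
  have lin: "linear (\<lambda>e. dd e g (?l s))"
    using dir_deriv_works[OF smooth_on_differentiable[OF assms(1)] D[of s]]
    by (rule has_derivative_linear)
  have "((\<lambda>s. g (?l s)) has_derivative (\<lambda>r. dd (r *\<^sub>R axis a 1, 0) g (?l s))) (at s within UNIV)"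
    by (rule has_derivative_in_compose2[where t = D and g = g])
      (auto intro!: derivative_eq_intros dir_deriv_works smooth_on_differentiable[OF assms(1)] D)
  moreover have "dd (r *\<^sub>R axis a 1, 0) g (?l s) = r *\<^sub>R d_space T a g (?l s)" for r
    using linear_scale[OF lin, of r "(axis a 1, 0)"] by (simp add: d_space_def)
  ultimately show ?thesis
    by (simp add: has_vector_derivative_def)
qed

lemma has_vector_derivative_time:
  assumes "sm g" "t \<in> {0..T}"
  shows "((\<lambda>t. g (x, t)) has_vector_derivative d_time T g (x, t)) (at t within {0..T})"
proof -
  have lin: "linear (\<lambda>e. dd e g (x, t))"
    using dir_deriv_works[OF smooth_on_differentiable[OF assms(1)], of "(x,t)"] assms(2)
    by (auto intro!: has_derivative_linear simp: slab_iff)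
  have "((\<lambda>t. g (x, t)) has_derivative (\<lambda>r. dd (0, r) g (x, t))) (at t within {0..T})"
    by (rule has_derivative_in_compose2[where t = D and g = g])
      (use assms in \<open>auto intro!: derivative_eq_intros dir_deriv_works smooth_on_differentiable[OF assms(1)] simp: slab_iff\<close>)
  moreover have "dd (0, r) g (x, t) = r *\<^sub>R d_time T g (x, t)" for r
    using linear_scale[OF lin, of r "(0, 1)"] by (simp add: d_time_def)
  ultimately show ?thesis
    by (simp add: has_vector_derivative_def)
qed

lemma constant_in_space:
  assumes "sm g" "t \<in> {0..T}" "\<And>a z. z \<in> D \<Longrightarrow> d_space T a g z = 0"
  shows "g (x, t) = g (y, t)"
proof -
  have shift: "g (x + r *\<^sub>R axis a 1, t) = g (x, t)" for x r a
  proof -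
    have "((\<lambda>s. g (x + s *\<^sub>R axis a 1, t)) has_derivative (\<lambda>_. 0)) (at s within UNIV)" for s
      using has_vector_derivative_space[OF assms(1,2), of x a s] assms(2,3)
      by (simp add: has_vector_derivative_def slab_iff)
    from has_derivative_zero_unique[OF convex_UNIV this, of r 0]
    show ?thesis by simp
  qed
  have "y = (x + (y$1 - x$1) *\<^sub>R axis 1 1) + (y$2 - x$2) *\<^sub>R axis 2 1"
    by (simp add: vec_eq_iff forall_2 axis_def)
  then show ?thesis by (metis shift)
qed

end

section \<open>Integration over a period cell\<close>

text \<open>Cell coordinates form a pair of reals, so that Fubini on product boxes applies. The
  corner \<open>x\<close> is free, so that a vanishing integral can give information at any
  prescribed point.\<close>

definition cell_point :: "real^2 \<Rightarrow> real \<times> real \<Rightarrow> real \<Rightarrow> (real^2) \<times> real"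
  where "cell_point x q t = (x + fst q *\<^sub>R axis 1 1 + snd q *\<^sub>R axis 2 1, t)"

definition cell_integral :: "real^2 \<Rightarrow> real^2 \<Rightarrow> ((real^2) \<times> real \<Rightarrow> real) \<Rightarrow> real \<Rightarrow> real"
  where "cell_integral L x g t = integral (cbox (0, 0) (L $ 1, L $ 2)) (\<lambda>q. g (cell_point x q t))"

locale periodic_spacetime = spacetime +
  fixes L :: "real^2"
  assumes L_pos: "\<And>a. 0 < L $ a"
begin

abbreviation "per \<equiv> periodic_in_space T L"
abbreviation "cell \<equiv> cbox (0::real, 0::real) (L $ 1, L $ 2)"

lemma per_add: "per g \<Longrightarrow> per h \<Longrightarrow> per (\<lambda>p. g p + h p)"
  and per_mult: "per g \<Longrightarrow> per h \<Longrightarrow> per (\<lambda>p. g p * h p)"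
  and per_const: "per (\<lambda>p. c)"
  by (simp_all add: periodic_in_space_def)

lemma per_sum: "(\<And>i. i \<in> I \<Longrightarrow> per (g i)) \<Longrightarrow> per (\<lambda>p. \<Sum>i\<in>I. g i p)"
  by (simp add: periodic_in_space_def)

lemma per_d_space: "sm g \<Longrightarrow> per g \<Longrightarrow> per (d_space T a g)"
  by (simp add: d_space_def periodic_dd)

lemma per_advect: "sm g \<Longrightarrow> per g \<Longrightarrow> per (advect T c g)"
  unfolding advect_def by (intro per_sum per_mult per_const per_d_space)

lemmas per_intros = per_const per_add per_mult per_sum per_d_space per_advect

lemma cell_point_in: "t \<in> {0..T} \<Longrightarrow> cell_point x q t \<in> D"
  by (simp add: cell_point_def slab_iff)

lemma continuous_on_cell_time:
  fixes g :: "(real^2) \<times> real \<Rightarrow> real"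
  assumes "continuous_on D g"
  shows "continuous_on ({0..T} \<times> X) (\<lambda>(t, q). g (cell_point x q t))"
proof -
  have "continuous_on ({0..T} \<times> X) (\<lambda>z. cell_point x (snd z) (fst z))"
    unfolding cell_point_def by (intro continuous_intros)
  then have "continuous_on ({0..T} \<times> X) (\<lambda>z. g (cell_point x (snd z) (fst z)))"
    using cell_point_in by (intro continuous_on_compose2[OF assms]) auto
  then show ?thesis by (simp add: split_def)
qed

lemma continuous_on_cell:
  fixes g :: "(real^2) \<times> real \<Rightarrow> real"
  assumes "continuous_on D g" "t \<in> {0..T}"
  shows "continuous_on X (\<lambda>q. g (cell_point x q t))"
proof -
  have "continuous_on X (\<lambda>q. cell_point x q t)"
    unfolding cell_point_def by (intro continuous_intros)
  then show ?thesis
    using cell_point_in assms(2) by (intro continuous_on_compose2[OF assms(1)]) auto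
qed

lemma cell_integrable:
  fixes g :: "(real^2) \<times> real \<Rightarrow> real"
  assumes "continuous_on D g" "t \<in> {0..T}"
  shows "(\<lambda>q. g (cell_point x q t)) integrable_on cell"
  by (rule integrable_continuous[OF continuous_on_cell[OF assms]])

lemma cell_integral_space_deriv:
  assumes g: "sm g" "per g" and t: "t \<in> {0..T}"
  shows "cell_integral L x (d_space T a g) t = 0"
proof -
  let ?G = "d_space T a g"
  have cont: "continuous_on cell (\<lambda>q. ?G (cell_point x q t))"
    using smooth_on_continuous[OF sm_d_space[OF g(1)]] t by (rule continuous_on_cell)
  have line: "integral (cbox 0 (L $ a)) (\<lambda>s. ?G (y + s *\<^sub>R axis a 1, t)) = 0" for y
  proof -
    have "((\<lambda>s. ?G (y + s *\<^sub>R axis a 1, t)) has_integral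
        (g (y + (L $ a) *\<^sub>R axis a 1, t) - g (y + 0 *\<^sub>R axis a 1, t))) {0..L $ a}"
      by (rule fundamental_theorem_of_calculus[OF less_imp_le[OF L_pos]
            has_vector_derivative_at_within[OF has_vector_derivative_space[OF g(1) t]]])
    moreover have "(L $ a) *\<^sub>R axis a 1 = (axis a (L $ a) :: real^2)"
      by (simp add: vec_eq_iff axis_def)
    ultimately have "((\<lambda>s. ?G (y + s *\<^sub>R axis a 1, t)) has_integral 0) {0..L $ a}"
      using g(2) t by (auto simp: periodic_in_space_def)
    then show ?thesis by (simp add: integral_unique)
  qed
  have cont': "continuous_on cell (\<lambda>(r, s). ?G (cell_point x (r, s) t))"
    using cont by (simp add: split_def)
  have "cell_integral L x ?G t =
      integral (cbox 0 (L $ 1)) (\<lambda>r. integral (cbox 0 (L $ 2)) (\<lambda>s. ?G (cell_point x (r, s) t)))"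
    unfolding cell_integral_def by (rule integral_prod_continuous[OF cont])
  also have "\<dots> = 0"
  proof (cases "a = 1")
    \<comment> \<open>Fubini puts the second coordinate inside; for the first one the order of
      integration has to be swapped before periodicity along lines applies.\<close>
    case True
    have eq: "?G (cell_point x (r, s) t) = ?G ((x + s *\<^sub>R axis 2 1) + r *\<^sub>R axis 1 1, t)" for r s
      by (simp add: cell_point_def algebra_simps)
    show ?thesis
      unfolding integral_swap_continuous[OF cont'] unfolding eq using True line by simp
  next
    case False
    then have "a = 2" by (metis exhaust_2)
    then show ?thesis using line by (simp add: cell_point_def)
  qed
  finally show ?thesis .
qed

lemma cell_integral_time_deriv:
  assumes g: "sm g" and t: "t \<in> {0..T}"
  shows "(cell_integral L x g has_vector_derivative cell_integral L x (d_time T g) t) (at t within {0..T})"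
  unfolding cell_integral_def[abs_def]
proof (rule leibniz_rule_vector_derivative)
  show "continuous_on ({0..T} \<times> cell) (\<lambda>(t, q). d_time T g (cell_point x q t))"
    by (rule continuous_on_cell_time[OF smooth_on_continuous[OF sm_d_time[OF g]]])
  show "((\<lambda>t. g (cell_point x q t)) has_vector_derivative d_time T g (cell_point x q t))
      (at t within {0..T})" if "t \<in> {0..T}" for t q
    unfolding cell_point_def by (rule has_vector_derivative_time[OF g that])
qed (use t in \<open>auto intro: cell_integrable smooth_on_continuous[OF g]\<close>)

lemma cell_integral_mono:
  fixes g :: "(real^2) \<times> real \<Rightarrow> real"
  assumes "continuous_on D g" "continuous_on D h" "t \<in> {0..T}"
    and "\<And>q. q \<in> cell \<Longrightarrow> g (cell_point x q t) \<le> h (cell_point x q t)"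
  shows "cell_integral L x g t \<le> cell_integral L x h t"
  unfolding cell_integral_def
  by (rule integral_le[OF cell_integrable[OF assms(1,3)] cell_integrable[OF assms(2,3)] assms(4)])

lemma cell_integral_add:
  fixes g :: "(real^2) \<times> real \<Rightarrow> real"
  assumes "continuous_on D g" "continuous_on D h" "t \<in> {0..T}"
  shows "cell_integral L x (\<lambda>z. g z + h z) t = cell_integral L x g t + cell_integral L x h t"
  unfolding cell_integral_def by (intro integral_add cell_integrable assms)

lemma cell_integral_cmult: "cell_integral L x (\<lambda>z. c * g z) t = c * cell_integral L x g t"
  by (simp add: cell_integral_def)

text \<open>A continuous nonnegative function with zero integral vanishes on the cell, in particular
  at its corner, which is \<open>x\<close>.\<close>

lemma cell_integral_eq_0_imp:
  fixes g :: "(real^2) \<times> real \<Rightarrow> real"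
  assumes "continuous_on D g" "t \<in> {0..T}" "\<And>y. 0 \<le> g (y, t)" "cell_integral L x g t = 0"
  shows "g (x, t) = 0"
proof -
  have "((\<lambda>q. g (cell_point x q t)) has_integral 0) cell"
    using assms(4) cell_integrable[OF assms(1,2)] by (simp add: cell_integral_def has_integral_integrable_integral)
  moreover have "box (0, 0) (L $ 1, L $ 2) \<noteq> {}"
    using L_pos[of 1] L_pos[of 2] by (simp add: box_prod)
  moreover have "(0, 0) \<in> cell"
    using L_pos[of 1] L_pos[of 2] by simp
  moreover have "0 \<le> g (cell_point x q t)" for q
    using assms(3) by (simp add: cell_point_def)
  ultimately have "g (cell_point x (0, 0) t) = 0"
    by (metis has_integral_0_cbox_imp_0[OF continuous_on_cell[OF assms(1,2)]])
  then show ?thesis by (simp add: cell_point_def)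
qed

lemma cell_bound:
  fixes g :: "(real^2) \<times> real \<Rightarrow> real"
  assumes "continuous_on D g"
  obtains K where "0 \<le> K" "\<And>q t. q \<in> cell \<Longrightarrow> t \<in> {0..T} \<Longrightarrow> \<bar>g (cell_point x q t)\<bar> \<le> K"
proof -
  have "compact ((\<lambda>(t, q). g (cell_point x q t)) ` ({0..T} \<times> cell))"
    by (intro compact_continuous_image continuous_on_cell_time assms compact_Times) auto
  then have "bounded ((\<lambda>(t, q). g (cell_point x q t)) ` ({0..T} \<times> cell))"
    by (rule compact_imp_bounded)
  then obtain K where K: "\<And>y. y \<in> (\<lambda>(t, q). g (cell_point x q t)) ` ({0..T} \<times> cell) \<Longrightarrow> \<bar>y\<bar> \<le> K"
    unfolding bounded_iff real_norm_def by blast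
  have "\<bar>g (cell_point x q t)\<bar> \<le> max K 0" if "q \<in> cell" "t \<in> {0..T}" for q t
  proof -
    have "(\<lambda>(t, q). g (cell_point x q t)) (t, q) \<in> (\<lambda>(t, q). g (cell_point x q t)) ` ({0..T} \<times> cell)"
      using that by (intro imageI) simp
    then show ?thesis using K by fastforce
  qed
  then show thesis using that[of "max K 0"] by auto
qed

end

section \<open>The energy estimate\<close>

context periodic_spacetime
begin

text \<open>Multiplying by \<open>exp (- C * t)\<close> absorbs the right-hand side and leaves a
  nonincreasing function. At the endpoints only its continuity is used, so one-sided derivatives
  suffice there.\<close>

lemma gronwall_zero:
  fixes E E' :: "real \<Rightarrow> real"
  assumes deriv: "\<And>t. t \<in> {0..T} \<Longrightarrow> (E has_vector_derivative E' t) (at t within {0..T})"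
    and le: "\<And>t. t \<in> {0..T} \<Longrightarrow> E' t \<le> C * E t"
    and init: "E 0 \<le> 0" and t: "t \<in> {0..T}"
  shows "E t \<le> 0"
proof (cases "t = 0")
  case False
  with t have "0 < t" by simp
  let ?\<phi> = "\<lambda>t. exp (- C * t) * E t"
  have d: "(?\<phi> has_vector_derivative exp (- C * s) * (E' s - C * E s)) (at s within {0..T})"
    if "s \<in> {0..T}" for s
    using deriv[OF that] unfolding has_real_derivative_iff_has_vector_derivative[symmetric]
    by (auto intro!: derivative_eq_intros simp: algebra_simps)
  have "?\<phi> t \<le> ?\<phi> 0"
  proof (rule DERIV_nonpos_imp_decreasing_open[where f = ?\<phi>])
    fix s assume s: "0 < s" "s < t"
    then have "s \<in> {0..T}" and "at s within {0..T} = at s"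
      using t by (auto simp: at_within_Icc_at)
    then show "\<exists>y. (?\<phi> has_real_derivative y) (at s) \<and> y \<le> 0"
      using d[of s] le[of s] unfolding has_real_derivative_iff_has_vector_derivative
      by (metis mult_nonneg_nonpos exp_ge_zero diff_le_0_iff_le)
  next
    have "continuous_on {0..T} ?\<phi>"
      using d has_vector_derivative_continuous continuous_on_eq_continuous_within by blast
    then show "continuous_on {0..t} ?\<phi>"
      by (rule continuous_on_subset) (use t in auto)
  qed (use \<open>0 < t\<close> in simp)
  then show ?thesis using init
    by (metis exp_gt_zero mult_le_0_iff mult_zero_right exp_zero mult_1 not_less order_trans)
qed (use init in simp)

text \<open>\<open>R\<close> is the whole momentum flux, including pressure. \<open>dissip\<close>
  says that after removing the convective flux linearised at \<open>u\<close>, the rest pairs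
  nonpositively with the gradient of \<open>v\<close>.\<close>

lemma energy_zero:
  assumes v: "\<And>a. sm (v a)" "\<And>a. per (v a)" and u: "\<And>a. sm (u a)" "\<And>a. per (u a)"
    and R: "\<And>a b. sm (R a b)" "\<And>a b. per (R a b)"
    and evol: "\<And>a z. z \<in> D \<Longrightarrow> d_time T (v a) z + (\<Sum>b\<in>UNIV. d_space T b (R a b) z) = 0"
    and div: "\<And>z. z \<in> D \<Longrightarrow> (\<Sum>b\<in>UNIV. d_space T b (v b) z) = 0"
      "\<And>z. z \<in> D \<Longrightarrow> (\<Sum>b\<in>UNIV. d_space T b (u b) z) = 0"
    and dissip: "\<And>z. z \<in> D \<Longrightarrow> (\<Sum>a\<in>UNIV. \<Sum>b\<in>UNIV. d_space T b (v a) z * R a b z)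
      \<le> (\<Sum>a\<in>UNIV. \<Sum>b\<in>UNIV. d_space T b (v a) z * (u a z * v b z + v a z * u b z))"
    and init: "\<And>a x. v a (x, 0) = 0"
    and z: "z \<in> D"
  shows "v a z = 0"
proof -
  obtain x t where zxt: "z = (x, t)" and t: "t \<in> {0..T}" using z by (auto simp: slab_def)
  define e where "e = (\<lambda>p. v 1 p * v 1 p + v 2 p * v 2 p)"
  have e: "sm e" unfolding e_def by (intro sm_intros v)
  \<comment> \<open>Chosen so that \<open>\<partial>\<^sub>t e + 2 div flux\<close> contains no derivative of \<open>v\<close> other than those in \<open>dissip\<close>.\<close>
  define flux where "flux b = (\<lambda>p. (v 1 p * R 1 b p + v 2 p * R 2 b p)
    + ((-1/2) * (e p * u b p) + (-1) * ((v 1 p * u 1 p + v 2 p * u 2 p) * v b p)))" for b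
  have flux: "sm (flux b)" "per (flux b)" for b
    unfolding flux_def e_def by (intro sm_intros per_intros v u R)+
  have deriv: "d_space T a (flux b) z =
      (v 1 z * d_space T a (R 1 b) z + d_space T a (v 1) z * R 1 b z
       + v 2 z * d_space T a (R 2 b) z + d_space T a (v 2) z * R 2 b z)
      - (v 1 z * d_space T a (v 1) z + v 2 z * d_space T a (v 2) z) * u b z
      - 1/2 * e z * d_space T a (u b) z
      - (v 1 z * d_space T a (u 1) z + d_space T a (v 1) z * u 1 z
         + v 2 z * d_space T a (u 2) z + d_space T a (v 2) z * u 2 z) * v b z
      - (v 1 z * u 1 z + v 2 z * u 2 z) * d_space T a (v b) z" if "z \<in> D" for a b z
    unfolding flux_def e_def
    by (simp only: d_space_add[OF _ _ that] d_space_mult[OF _ _ that] d_space_const[OF that] sm_intros v u R)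
      (simp add: algebra_simps)
  have "\<forall>a b. \<exists>K. 0 \<le> K \<and>
      (\<forall>q\<in>cell. \<forall>t\<in>{0..T}. \<bar>d_space T b (u a) (cell_point x q t)\<bar> \<le> K)"
    using cell_bound[OF smooth_on_continuous[OF sm_d_space[OF u(1)]]] by metis
  then obtain K where "\<forall>a b. 0 \<le> K a b \<and>
      (\<forall>q\<in>cell. \<forall>t\<in>{0..T}. \<bar>d_space T b (u a) (cell_point x q t)\<bar> \<le> K a b)"
    unfolding choice_iff by (elim exE)
  then have K: "0 \<le> K a b"
    "q \<in> cell \<Longrightarrow> t \<in> {0..T} \<Longrightarrow> \<bar>d_space T b (u a) (cell_point x q t)\<bar> \<le> K a b" for a b q t
    by blast+
  define M where "M = K 1 1 + K 1 2 + K 2 1 + K 2 2"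
  have le: "d_time T e z \<le> (-2) * (d_space T 1 (flux 1) z + d_space T 2 (flux 2) z) + (2 * M) * e z"
    if z: "z = cell_point x q s" "q \<in> cell" "s \<in> {0..T}" for q s z
  proof -
    have zD: "z \<in> D" using z cell_point_in by simp
    have bd: "- 2 * (v a z * v b z * d_space T b (u a) z) \<le> 2 * K a b * e z" for a b
    proof -
      have "- (v a z * v b z * d_space T b (u a) z) \<le> \<bar>v a z\<bar> * \<bar>v b z\<bar> * \<bar>d_space T b (u a) z\<bar>"
        by (metis abs_ge_minus_self abs_mult)
      also have "\<dots> \<le> e z * K a b"
      proof (rule mult_mono)
        have "2 * (\<bar>v 1 z\<bar> * \<bar>v 2 z\<bar>) \<le> e z"
          using sum_squares_bound[of "\<bar>v 1 z\<bar>" "\<bar>v 2 z\<bar>"] by (simp add: e_def power2_eq_square)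
        moreover have "0 \<le> \<bar>v 1 z\<bar> * \<bar>v 2 z\<bar>" by simp
        ultimately have "\<bar>v 1 z\<bar> * \<bar>v 2 z\<bar> \<le> e z" by linarith
        moreover have "(a = 1 \<or> a = 2) \<and> (b = 1 \<or> b = 2)" using exhaust_2 by blast
        ultimately show "\<bar>v a z\<bar> * \<bar>v b z\<bar> \<le> e z"
          by (auto simp: e_def mult.commute)
      qed (use K z in \<open>auto simp: e_def\<close>)
      finally show ?thesis by simp
    qed
    have t1: "d_time T e z = 2 * (v 1 z * d_time T (v 1) z + v 2 z * d_time T (v 2) z)"
      unfolding e_def using zD by (simp add: d_time_add d_time_mult sm_intros v)
    have t2: "d_time T (v a) z = - (d_space T 1 (R a 1) z + d_space T 2 (R a 2) z)" for a
      using evol[OF zD, of a] by (simp add: sum_2)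
    have d1: "d_space T 2 (v 2) z = - d_space T 1 (v 1) z" and d2: "d_space T 2 (u 2) z = - d_space T 1 (u 1) z"
      using div[OF zD] by (simp_all add: sum_2)
    \<comment> \<open>As \<open>u\<close> and \<open>v\<close> are divergence free, the summed
      products of \<open>d_space T b (v a)\<close> with \<open>v a * u b\<close> and with
      \<open>u a * v b\<close> are divergences, the second up to
      \<open>v a * v b * d_space T b (u a)\<close>. These four terms are all that remains to be
      bounded.\<close>
    have "d_time T e z \<le> (-2) * (d_space T 1 (flux 1) z + d_space T 2 (flux 2) z)
       + (- 2 * (v 1 z * v 1 z * d_space T 1 (u 1) z)) + (- 2 * (v 1 z * v 2 z * d_space T 2 (u 1) z))
       + (- 2 * (v 2 z * v 1 z * d_space T 1 (u 2) z)) + (- 2 * (v 2 z * v 2 z * d_space T 2 (u 2) z))"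
      using dissip[OF zD] unfolding t1 t2 deriv[OF zD] sum_2 d1 d2
      by (simp add: algebra_simps)
    then show ?thesis
      using bd[of 1 1] bd[of 1 2] bd[of 2 1] bd[of 2 2] unfolding M_def
      by (simp add: algebra_simps)
  qed
  have cont: "continuous_on D g" if "sm g" for g :: "(real^2) \<times> real \<Rightarrow> real"
    using that by (rule smooth_on_continuous)
  let ?J = "cell_integral L x"
  have J: "?J e s \<le> 0" if "s \<in> {0..T}" for s
  proof (rule gronwall_zero[OF _ _ _ that])
    show "(?J e has_vector_derivative ?J (d_time T e) t) (at t within {0..T})" if "t \<in> {0..T}" for t
      using cell_integral_time_deriv[OF e that] .
    show "?J (d_time T e) t \<le> (2 * M) * ?J e t" if t: "t \<in> {0..T}" for t
    proof -
      let ?d = "\<lambda>b. d_space T b (flux b)"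
      have "?J (d_time T e) t \<le> ?J (\<lambda>z. (-2) * (?d 1 z + ?d 2 z) + (2 * M) * e z) t"
        by (intro cell_integral_mono cont sm_intros e flux t le[OF refl])
      also have "\<dots> = (-2) * (?J (?d 1) t + ?J (?d 2) t) + (2 * M) * ?J e t"
        by (simp only: cell_integral_add cell_integral_cmult cont sm_intros e flux t)
      also have "\<dots> = (2 * M) * ?J e t"
        by (simp add: cell_integral_space_deriv[OF flux t])
      finally show ?thesis .
    qed
    show "?J e 0 \<le> 0"
      by (simp add: cell_integral_def cell_point_def e_def init)
  qed
  have "0 \<le> ?J e t"
    unfolding cell_integral_def
    by (intro integral_nonneg cell_integrable cont e t) (simp add: e_def)
  with J[OF t] have "?J e t = 0" by simp
  with cell_integral_eq_0_imp[OF cont[OF e] t] have "e z = 0"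
    by (simp add: zxt e_def)
  then have "v 1 z = 0 \<and> v 2 z = 0"
    by (simp add: e_def sum_squares_eq_zero_iff)
  then show ?thesis by (metis exhaust_2)
qed

end

section \<open>Parity of formal power series\<close>

text \<open>Of two indices with an odd sum one is odd, so only the two end terms of the convolution
  survive. The strict bound \<open>n < N\<close> leaves the coefficient \<open>N\<close>, the first
  open one, arbitrary.\<close>

lemma fps_mult_odd_nth:
  fixes a b :: "'a::comm_ring_1 fps"
  assumes "odd N"
    and "\<And>n. odd n \<Longrightarrow> n < N \<Longrightarrow> fps_nth a n = 0"
    and "\<And>n. odd n \<Longrightarrow> n < N \<Longrightarrow> fps_nth b n = 0"
  shows "fps_nth (a * b) N = fps_nth a 0 * fps_nth b N + fps_nth a N * fps_nth b 0"
proof -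
  have "0 < N" using assms(1) by (rule odd_pos)
  have "fps_nth (a * b) N = (\<Sum>i\<in>{0..N}. fps_nth a i * fps_nth b (N - i))"
    by (rule fps_mult_nth)
  also have "\<dots> = (\<Sum>i\<in>{0, N}. fps_nth a i * fps_nth b (N - i))"
  proof (rule sum.mono_neutral_right)
    show "\<forall>i\<in>{0..N} - {0, N}. fps_nth a i * fps_nth b (N - i) = 0"
    proof
      fix i assume "i \<in> {0..N} - {0, N}"
      then have i: "0 < i" "i < N" by auto
      show "fps_nth a i * fps_nth b (N - i) = 0"
      proof (cases "odd i")
        case False
        then have "odd (N - i)" using assms(1) i by simp
        then show ?thesis using assms(3)[of "N - i"] i by simp
      qed (use assms(2) i in simp)
    qed
  qed auto
  also have "\<dots> = fps_nth a 0 * fps_nth b N + fps_nth a N * fps_nth b 0"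
    using \<open>0 < N\<close> by simp
  finally show ?thesis .
qed

text \<open>In \<open>b * b ^ i\<close> the open coefficient of \<open>b\<close> meets the constant
  term of \<open>b ^ i\<close>, which is nonzero only for \<open>i = 0\<close>.\<close>

lemma fps_power_odd_nth:
  fixes b :: "'a::comm_ring_1 fps"
  assumes b0: "fps_nth b 0 = 0"
  shows "odd N \<Longrightarrow> (\<And>n. odd n \<Longrightarrow> n < N \<Longrightarrow> fps_nth b n = 0) \<Longrightarrow>
    fps_nth (b ^ i) N = (if i = 1 then fps_nth b N else 0)"
proof (induction i arbitrary: N)
  case 0
  then show ?case by (auto simp: odd_pos)
next
  case (Suc i)
  have "fps_nth (b ^ i) n = 0" if "odd n" "n < N" for n
    using Suc.IH[of n] Suc.prems that by auto
  then have "fps_nth (b * b ^ i) N = fps_nth b 0 * fps_nth (b ^ i) N + fps_nth b N * fps_nth (b ^ i) 0"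
    using Suc.prems by (intro fps_mult_odd_nth)
  then show ?case
    by (cases i) (simp_all add: b0 fps_power_zeroth)
qed

lemma fps_compose_odd_nth:
  fixes a b :: "'a::comm_ring_1 fps"
  assumes "fps_nth b 0 = 0" "odd N" "\<And>n. odd n \<Longrightarrow> n < N \<Longrightarrow> fps_nth b n = 0"
  shows "fps_nth (a oo b) N = fps_nth a 1 * fps_nth b N"
proof -
  have "fps_nth (a oo b) N = (\<Sum>i=0..N. if i = 1 then fps_nth a 1 * fps_nth b N else 0)"
    unfolding fps_compose_nth
    by (rule sum.cong) (use fps_power_odd_nth[OF assms] in auto)
  also have "\<dots> = fps_nth a 1 * fps_nth b N"
    using odd_pos[OF assms(2)] by simp
  finally show ?thesis .
qed

lemma formal_taylor_nth_0: "fps_nth (formal_taylor \<mu> G) 0 = \<mu> (fps_nth G 0)"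
  by (simp add: formal_taylor_def)

text \<open>Only the linear Taylor term reaches the first odd coefficient, since quadratic and
  higher powers of the increment contribute nothing there.\<close>

lemma formal_taylor_odd_nth:
  assumes "odd N" "\<And>n. odd n \<Longrightarrow> n < N \<Longrightarrow> fps_nth G n = 0"
  shows "fps_nth (formal_taylor \<mu> G) N = dir_deriv {0..} 1 \<mu> (fps_nth G 0) * fps_nth G N"
proof -
  have "fps_nth (G - fps_const (fps_nth G 0)) n = fps_nth G n" if "odd n" for n
    using odd_pos[OF that] by simp
  then show ?thesis
    unfolding formal_taylor_def using assms by (subst fps_compose_odd_nth) auto
qed

lemma trace_square_odd_nth:
  fixes S :: "real fps^2^2"
  assumes "odd N" "\<And>n a b. odd n \<Longrightarrow> n < N \<Longrightarrow> fps_nth (S $ a $ b) n = 0"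
  shows "fps_nth (trace (S ** S)) N =
    2 * (\<Sum>a\<in>UNIV. \<Sum>b\<in>UNIV. fps_nth (S $ a $ b) 0 * fps_nth (S $ b $ a) N)"
proof -
  have "fps_nth (S $ a $ b * S $ b $ a) N =
    fps_nth (S $ a $ b) 0 * fps_nth (S $ b $ a) N + fps_nth (S $ a $ b) N * fps_nth (S $ b $ a) 0" for a b
    using assms by (intro fps_mult_odd_nth)
  then show ?thesis
    by (simp add: trace_def matrix_matrix_mult_def fps_sum_nth sum_2 algebra_simps)
qed

lemma strain_sym: "strain T f n z $ a $ b = strain T f n z $ b $ a"
  by (simp add: strain_def transpose_def)

lemma trace_strain_series_nth_0:
  "fps_nth (trace (strain_series T f z ** strain_series T f z)) 0
    = contract (strain T f 1 z) (strain T f 1 z)"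
  by (simp add: trace_def matrix_matrix_mult_def fps_sum_nth strain_series_def contract_def
      strain_sym[of T f _ z 1 2] sum_2)

lemma mu_series_nth_0:
  "fps_nth (mu_series \<mu> T f z) 0 = \<mu> (contract (strain T f 1 z) (strain T f 1 z))"
  by (simp add: mu_series_def formal_taylor_nth_0 trace_strain_series_nth_0)

text \<open>Pitfall: odd coefficients of \<open>S\<^sub>h/h\<close> are the strains of even order.\<close>

lemma mu_series_odd_nth:
  assumes "odd N" "\<And>n. even n \<Longrightarrow> n \<le> N \<Longrightarrow> strain T f n z = 0"
  shows "fps_nth (mu_series \<mu> T f z) N =
    dir_deriv {0..} 1 \<mu> (contract (strain T f 1 z) (strain T f 1 z))
      * (2 * contract (strain T f 1 z) (strain T f (Suc N) z))"
proof -
  let ?S = "strain_series T f z"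
  have S: "fps_nth (?S $ a $ b) n = 0" if "odd n" "n < N" for n a b
    using assms(2)[of "Suc n"] that by (simp add: strain_series_def)
  have tr: "fps_nth (trace (?S ** ?S)) n = 2 * contract (strain T f 1 z) (strain T f (Suc n) z)"
    if "odd n" "n \<le> N" for n
    using that S
    by (subst trace_square_odd_nth) (auto simp: strain_series_def contract_def sum_2 strain_sym[of T f _ z 2 1])
  have "fps_nth (trace (?S ** ?S)) n = 0" if "odd n" "n < N" for n
    using tr[of n] assms(2)[of "Suc n"] that by (simp add: contract_def)
  then show ?thesis
    unfolding mu_series_def using assms(1)
    by (simp add: formal_taylor_odd_nth trace_strain_series_nth_0 tr)
qed

lemma mu_series_odd_nth_eq_0:
  assumes "odd N" "\<And>n. even n \<Longrightarrow> n \<le> Suc N \<Longrightarrow> strain T f n z = 0"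
  shows "fps_nth (mu_series \<mu> T f z) N = 0"
  using mu_series_odd_nth[of N T f z \<mu>] assms by (simp add: contract_def)

section \<open>Lattice moments\<close>

lemma vel_simps:
  "vel 0 = vector [0, 0]" "vel (Suc 0) = vector [1, 0]" "vel 2 = vector [0, 1]" "vel 3 = vector [-1, 0]"
  "vel 4 = vector [0, -1]" "vel 5 = vector [1, 1]" "vel 6 = vector [-1, 1]" "vel 7 = vector [-1, -1]"
  "vel 8 = vector [1, -1]"
  by (simp_all add: vel_def eval_nat_numeral)

lemma weight_simps:
  "weight 0 = 16/36" "weight (Suc 0) = 4/36" "weight 2 = 4/36" "weight 3 = 4/36" "weight 4 = 4/36"
  "weight 5 = 1/36" "weight 6 = 1/36" "weight 7 = 1/36" "weight 8 = 1/36"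
  by (simp_all add: weight_def eval_nat_numeral)

lemma opp_simps:
  "opp 0 = 0" "opp (Suc 0) = 3" "opp 2 = 4" "opp 3 = Suc 0" "opp 4 = 2" "opp 5 = 7" "opp 6 = 8" "opp 7 = 5" "opp 8 = 6"
  by (simp_all add: opp_def eval_nat_numeral)

lemma atMost_8: "{..8::nat} = {0, 1, 2, 3, 4, 5, 6, 7, 8}"
  by auto

lemma sum_atMost_8: "(\<Sum>i\<le>(8::nat). g i) = g 0 + g (Suc 0) + g 2 + g 3 + g 4 + g 5 + g 6 + g 7 + (g 8 :: 'a::comm_monoid_add)"
  unfolding atMost_8 by (simp add: ac_simps)

lemma le_8_cases: "i \<le> 8 \<longleftrightarrow> i = 0 \<or> i = Suc 0 \<or> i = 2 \<or> i = 3 \<or> i = 4 \<or> i = 5 \<or> i = 6 \<or> i = 7 \<or> i = (8::nat)"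
  by auto

lemma opp_le: "i \<le> 8 \<Longrightarrow> opp i \<le> 8"
  and opp_opp: "i \<le> 8 \<Longrightarrow> opp (opp i) = i"
  and weight_opp: "i \<le> 8 \<Longrightarrow> weight (opp i) = weight i"
  unfolding le_8_cases by (auto simp: opp_simps weight_simps)

lemma sum_opp: "(\<Sum>i\<le>8. g (opp i)) = (\<Sum>i\<le>8. g i :: 'a::comm_monoid_add)"
  by (rule sum.reindex_bij_witness[of _ opp opp]) (auto simp: opp_le opp_opp)

text \<open>Parity information concerns opposite pairs of directions; this rewrites a sum over
  directions in terms of such pairs.\<close>

lemma sum_even_part:
  fixes g :: "nat \<Rightarrow> real"
  shows "(\<Sum>i\<le>8. g i) = (\<Sum>i\<le>8. (g i + g (opp i)) / 2)"
  using sum_opp[of g] by (simp add: sum.distrib flip: sum_divide_distrib)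

lemma sum_odd_eq_0:
  fixes g :: "nat \<Rightarrow> real"
  assumes "\<And>i. i \<le> 8 \<Longrightarrow> g (opp i) = - g i"
  shows "(\<Sum>i\<le>8. g i) = 0"
  using assms by (subst sum_even_part) simp

lemmas lattice_simps = sum_atMost_8 vel_simps weight_simps inner_vec_def sum_2

lemma f_quad_sym: "f_quad i u v = f_quad i v u"
  by (simp add: f_quad_def inner_commute)

lemma f_quad_opp: "i \<le> 8 \<Longrightarrow> f_quad (opp i) u v = f_quad i u v"
  by (simp add: f_quad_def weight_opp vel_opp)

lemma f_quad_0: "f_quad i 0 v = 0" "f_quad i u 0 = 0"
  by (simp_all add: f_quad_def)

lemma vel_tensor_opp: "i \<le> 8 \<Longrightarrow> vel_tensor (opp i) = vel_tensor i"
  by (simp add: vel_tensor_def vel_opp)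

lemma contract_vel_tensor:
  "contract S (vel_tensor i) = (\<Sum>a\<in>UNIV. \<Sum>b\<in>UNIV. S $ a $ b * (vel i $ a * vel i $ b))"
  by (simp add: contract_def vel_tensor_def)

text \<open>The second moments of the weights are \<delta>/3, and 9/2 * 1/3 = 3/2.\<close>

lemma sum_f_quad: "(\<Sum>i\<le>8. f_quad i u v) = 0"
  by (simp add: f_quad_def lattice_simps field_simps)

lemma sum_vel_f_quad: "(\<Sum>i\<le>8. vel i $ a * f_quad i u v) = 0"
  by (rule sum_odd_eq_0) (simp add: f_quad_opp vel_opp)

lemma sum_f_lin: "(\<Sum>i\<le>8. f_lin i r v) = r"
  by (simp add: f_lin_def lattice_simps field_simps)

lemma sum_vel_f_lin: "(\<Sum>i\<le>8. vel i $ a * f_lin i r v) = v $ a"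
  using exhaust_2[of a] by (auto simp: f_lin_def lattice_simps field_simps)

lemma sum_weight_tensor: "(\<Sum>i\<le>8. weight i * contract S (vel_tensor i)) = (S $ 1 $ 1 + S $ 2 $ 2) / 3"
  by (simp add: contract_vel_tensor lattice_simps field_simps)

lemma sum_weight_vel_vel: "(\<Sum>i\<le>8. weight i * (vel i $ a * vel i $ b)) = (if a = b then 1/3 else 0)"
  using exhaust_2[of a] exhaust_2[of b] by (auto simp: lattice_simps field_simps)

text \<open>The isotropic part of the fourth moment is cancelled by the term with 3/2 in
  \<open>f_quad\<close>; the two other pairings give the convective flux.\<close>

lemma sum_vel_vel_f_quad:
  "(\<Sum>i\<le>8. vel i $ a * vel i $ b * f_quad i u v) = (u $ a * v $ b + v $ a * u $ b) / 2"
  using exhaust_2[of a] exhaust_2[of b] by (auto simp: f_quad_def lattice_simps field_simps)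

text \<open>The weighted fourth moment of D2Q9 is isotropic, 1/9 times the sum of the three pairings
  of \<delta>. Zero trace removes one pairing, and symmetry makes the other two equal.\<close>

lemma sum_weight_vel_vel_tensor:
  assumes "S $ 1 $ 2 = S $ 2 $ 1" "S $ 1 $ 1 + S $ 2 $ 2 = 0"
  shows "(\<Sum>i\<le>8. weight i * (vel i $ a * vel i $ b * contract S (vel_tensor i))) = 2/9 * S $ a $ b"
proof -
  have "S $ 2 $ 2 = - S $ 1 $ 1" using assms(2) by simp
  then show ?thesis using assms(1) exhaust_2[of a] exhaust_2[of b]
    by (auto simp: contract_vel_tensor lattice_simps field_simps)
qed

section \<open>Streaming operators\<close>

text \<open>For \<open>j = 1\<close> this is the coefficient of \<open>h^n\<close> in \<open>f\<^sub>i (x + h c\<^sub>i, t + h\<^sup>2) - f\<^sub>i (x, t)\<close>;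
  \<open>j > 1\<close> drops the terms with the most recent coefficients, whose parity is not yet known.\<close>

definition streaming :: "real \<Rightarrow> family \<Rightarrow> nat \<Rightarrow> nat \<Rightarrow> nat \<Rightarrow> (real^2) \<times> real \<Rightarrow> real"
  where "streaming T f j n i z = (\<Sum>s=j..n. D_op T i s (f (n - s) i) z)"

lemma streaming_Suc: "j \<le> n \<Longrightarrow>
    streaming T f j n i z = D_op T i j (f (n - j) i) z + streaming T f (Suc j) n i z"
  by (simp add: streaming_def sum.atLeast_Suc_atMost)

context spacetime
begin

lemma advect_cong: "\<lbrakk>\<And>q. q \<in> D \<Longrightarrow> g q = h q; z \<in> D\<rbrakk> \<Longrightarrow> advect T c g z = advect T c h z"
  unfolding advect_def by (intro sum.cong arg_cong2[of _ _ _ _ "(*)"] d_space_cong refl)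

lemma advect_uminus: "advect T (- c) g z = - advect T c g z"
  by (simp add: advect_def sum_negf)

lemma advect_cmult: "\<lbrakk>sm g; z \<in> D\<rbrakk> \<Longrightarrow> advect T c (\<lambda>p. r * g p) z = r * advect T c g z"
  by (simp add: advect_def d_space_mult sm_const d_space_const sum_distrib_left mult.left_commute)

lemma advect_add: "\<lbrakk>sm g; sm h; z \<in> D\<rbrakk> \<Longrightarrow>
    advect T c (\<lambda>p. g p + h p) z = advect T c g z + advect T c h z"
  by (simp add: advect_def d_space_add sum.distrib distrib_left)

lemma advect_const: "z \<in> D \<Longrightarrow> advect T c (\<lambda>p. r) z = 0"
  by (simp add: advect_def d_space_const)

lemma sm_advect_iter: "sm g \<Longrightarrow> sm ((advect T c ^^ l) g)"
  by (induction l) (auto intro: sm_advect)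

lemma sm_d_time_iter: "sm g \<Longrightarrow> sm ((d_time T ^^ l) g)"
  by (induction l) (auto intro: sm_d_time)

lemma advect_iter_cong: "\<lbrakk>\<And>q. q \<in> D \<Longrightarrow> g q = h q; z \<in> D\<rbrakk> \<Longrightarrow>
    (advect T c ^^ l) g z = (advect T c ^^ l) h z"
  by (induction l arbitrary: z) (auto intro: advect_cong simp del: split_paired_All)

lemma d_time_iter_cong: "\<lbrakk>\<And>q. q \<in> D \<Longrightarrow> g q = h q; z \<in> D\<rbrakk> \<Longrightarrow>
    (d_time T ^^ l) g z = (d_time T ^^ l) h z"
  by (induction l arbitrary: z) (auto intro: d_time_cong simp del: split_paired_All)

lemma d_time_cmult: "\<lbrakk>sm g; z \<in> D\<rbrakk> \<Longrightarrow> d_time T (\<lambda>p. r * g p) z = r * d_time T g z"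
  by (simp add: d_time_mult sm_const d_time_const)

lemma advect_iter_cmult: "\<lbrakk>sm g; z \<in> D\<rbrakk> \<Longrightarrow>
    (advect T c ^^ l) (\<lambda>p. r * g p) z = r * (advect T c ^^ l) g z"
proof (induction l arbitrary: z)
  case (Suc l)
  have "advect T c ((advect T c ^^ l) (\<lambda>p. r * g p)) z = advect T c (\<lambda>p. r * (advect T c ^^ l) g p) z"
    using Suc by (intro advect_cong)
  then show ?case using Suc.prems by (simp add: advect_cmult sm_advect_iter)
qed simp

lemma d_time_iter_cmult: "\<lbrakk>sm g; z \<in> D\<rbrakk> \<Longrightarrow>
    (d_time T ^^ l) (\<lambda>p. r * g p) z = r * (d_time T ^^ l) g z"
proof (induction l arbitrary: z)
  case (Suc l)
  have "d_time T ((d_time T ^^ l) (\<lambda>p. r * g p)) z = d_time T (\<lambda>p. r * (d_time T ^^ l) g p) z"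
    using Suc by (intro d_time_cong)
  then show ?case using Suc.prems by (simp add: d_time_cmult sm_d_time_iter)
qed simp

lemma advect_iter_uminus: "\<lbrakk>sm g; z \<in> D\<rbrakk> \<Longrightarrow>
    (advect T (- c) ^^ l) g z = (-1) ^ l * (advect T c ^^ l) g z"
proof (induction l arbitrary: z)
  case (Suc l)
  have "advect T (- c) ((advect T (- c) ^^ l) g) z = advect T (- c) (\<lambda>p. (-1) ^ l * (advect T c ^^ l) g p) z"
    using Suc by (intro advect_cong)
  also have "\<dots> = - advect T c (\<lambda>p. (-1) ^ l * (advect T c ^^ l) g p) z"
    by (rule advect_uminus)
  also have "\<dots> = (-1) ^ Suc l * (advect T c ^^ Suc l) g z"
    using Suc.prems by (simp add: advect_cmult sm_advect_iter)
  finally show ?case by (simp only: funpow.simps o_apply)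
qed simp

lemma D_op_cong:
  assumes "\<And>q. q \<in> D \<Longrightarrow> g q = h q" "z \<in> D"
  shows "D_op T i s g z = D_op T i s h z"
proof -
  have "(d_time T ^^ m) ((advect T (vel i) ^^ l) g) z = (d_time T ^^ m) ((advect T (vel i) ^^ l) h) z" for l m
    using assms by (intro d_time_iter_cong advect_iter_cong)
  then show ?thesis by (simp add: D_op_def)
qed

lemma D_op_cmult:
  assumes "sm g" "z \<in> D"
  shows "D_op T i s (\<lambda>p. r * g p) z = r * D_op T i s g z"
proof -
  have "(d_time T ^^ m) ((advect T (vel i) ^^ l) (\<lambda>p. r * g p)) z
      = r * (d_time T ^^ m) ((advect T (vel i) ^^ l) g) z" for l m
    using assms
    by (subst d_time_iter_cong[where h = "\<lambda>p. r * (advect T (vel i) ^^ l) g p"])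
      (simp_all add: advect_iter_cmult d_time_iter_cmult sm_advect_iter)
  then show ?thesis
    by (simp add: D_op_def sum_distrib_left split_def mult.assoc mult.left_commute)
qed

lemma D_op_opp:
  assumes "i \<le> 8" "sm g" "z \<in> D"
  shows "D_op T (opp i) s g z = (-1) ^ s * D_op T i s g z"
proof -
  have "(d_time T ^^ m) ((advect T (vel (opp i)) ^^ l) g) z
      = (-1) ^ l * (d_time T ^^ m) ((advect T (vel i) ^^ l) g) z" for l m
    using assms
    by (subst d_time_iter_cong[where h = "\<lambda>p. (-1) ^ l * (advect T (vel i) ^^ l) g p"])
      (simp_all add: vel_opp advect_iter_uminus d_time_iter_cmult sm_advect_iter)
  then have "D_op T (opp i) s g z = (\<Sum>(l, m)\<in>{(l, m). l + 2 * m = s}.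
      (-1) ^ l * (1 / (fact l * fact m) * (d_time T ^^ m) ((advect T (vel i) ^^ l) g) z))"
    unfolding D_op_def by (intro sum.cong) auto
  also have "\<dots> = (\<Sum>(l, m)\<in>{(l, m). l + 2 * m = s}.
      (-1) ^ s * (1 / (fact l * fact m) * (d_time T ^^ m) ((advect T (vel i) ^^ l) g) z))"
    \<comment> \<open>\<open>l\<close> and \<open>s\<close> have the same parity, because
      \<open>s = l + 2 * m\<close>.\<close>
    by (intro sum.cong) (auto simp: power_add)
  also have "\<dots> = (-1) ^ s * D_op T i s g z"
    by (simp add: D_op_def sum_distrib_left split_def)
  finally show ?thesis .
qed

lemma D_op_1: "D_op T i (Suc 0) g z = advect T (vel i) g z"
proof -
  have "{(l, m). l + 2 * m = Suc 0} = {(Suc 0, 0)}" by auto presburger+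
  then show ?thesis by (simp add: D_op_def)
qed

lemma D_op_2: "D_op T i 2 g z = d_time T g z + advect T (vel i) (advect T (vel i) g) z / 2"
proof -
  have "{(l, m). l + 2 * m = 2} = {(2::nat, 0::nat), (0, 1)}" by auto presburger+
  then show ?thesis by (simp add: D_op_def eval_nat_numeral)
qed

lemma D_op_2_const: "z \<in> D \<Longrightarrow> D_op T i 2 (\<lambda>p. c) z = 0"
  using advect_cong[of "advect T (vel i) (\<lambda>p. c)" "\<lambda>p. 0" z "vel i"]
  by (simp add: D_op_2 d_time_const advect_const)

end

section \<open>Parity, moments and streaming of a formal expansion\<close>

locale lattice_expansion = periodic_spacetime +
  fixes f :: family
  assumes f_smooth: "\<And>n i. i \<le> 8 \<Longrightarrow> sm (f n i)"
    and f_periodic: "\<And>n i. i \<le> 8 \<Longrightarrow> per (f n i)"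
    and f_zero: "\<And>i z. i \<le> 8 \<Longrightarrow> z \<in> D \<Longrightarrow> f 0 i z = weight i"
begin

definition symmetric :: "nat \<Rightarrow> bool"
  where "symmetric m \<longleftrightarrow> (\<forall>i\<le>8. \<forall>z\<in>D. f m (opp i) z = (-1) ^ m * f m i z)"

abbreviation "str \<equiv> streaming T f"

definition divergence :: "nat \<Rightarrow> (real^2) \<times> real \<Rightarrow> real"
  where "divergence n z = (\<Sum>a\<in>UNIV. d_space T a (\<lambda>q. mom f n q $ a) z)"

lemma symmetricD: "\<lbrakk>symmetric m; i \<le> 8; z \<in> D\<rbrakk> \<Longrightarrow> f m (opp i) z = (-1) ^ m * f m i z"
  by (simp add: symmetric_def)

lemma symmetric_0: "symmetric 0"
  by (simp add: symmetric_def f_zero opp_le weight_opp)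

lemma D_op_symmetric:
  assumes "symmetric m" "i \<le> 8" "z \<in> D"
  shows "D_op T (opp i) s (f m (opp i)) z = (-1) ^ (s + m) * D_op T i s (f m i) z"
proof -
  have "D_op T (opp i) s (f m (opp i)) z = D_op T (opp i) s (\<lambda>p. (-1) ^ m * f m i p) z"
    by (rule D_op_cong) (use assms in \<open>auto simp: symmetricD\<close>)
  then show ?thesis
    using assms by (simp add: D_op_cmult f_smooth D_op_opp power_add)
qed

text \<open>The order of the operator and that of the coefficient it acts on add up to
  \<open>n\<close> in every term, so all terms carry the same sign.\<close>

lemma streaming_symmetric:
  assumes "\<And>m. m + j \<le> n \<Longrightarrow> symmetric m" "i \<le> 8" "z \<in> D"
  shows "str j n (opp i) z = (-1) ^ n * str j n i z"
  unfolding streaming_def sum_distrib_left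
  by (rule sum.cong) (use assms in \<open>auto simp: D_op_symmetric\<close>)

lemma sm_rho: "sm (rho f n)"
  unfolding rho_def[abs_def] by (intro sm_intros f_smooth) simp

lemma mom_nth: "mom f n z $ a = (\<Sum>i\<le>8. vel i $ a * f n i z)"
  by (simp add: mom_def mult.commute)

lemma sm_mom: "sm (\<lambda>z. mom f n z $ a)"
  unfolding mom_nth by (intro sm_intros f_smooth) simp

lemma per_mom: "per (\<lambda>z. mom f n z $ a)"
  unfolding mom_nth by (intro per_intros f_periodic) simp

lemma mom_symmetric: "\<lbrakk>symmetric n; even n; z \<in> D\<rbrakk> \<Longrightarrow> mom f n z = 0"
  by (simp add: vec_eq_iff mom_nth sum_odd_eq_0 symmetricD vel_opp)

lemma strain_nth: "strain T f n z $ a $ b =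
    d_space T a (\<lambda>q. mom f n q $ b) z + d_space T b (\<lambda>q. mom f n q $ a) z"
  by (simp add: strain_def grad_def transpose_def)

lemma strain_symmetric:
  assumes "symmetric n" "even n" "z \<in> D"
  shows "strain T f n z = 0"
proof -
  have "d_space T a (\<lambda>q. mom f n q $ b) z = d_space T a (\<lambda>q. 0) z" for a b
    by (rule d_space_cong) (use assms in \<open>simp_all add: mom_symmetric\<close>)
  then show ?thesis
    using assms(3) by (simp add: vec_eq_iff strain_nth d_space_const)
qed

lemma trace_strain: "strain T f n z $ 1 $ 1 + strain T f n z $ 2 $ 2 = 2 * divergence n z"
  by (simp add: strain_nth divergence_def sum_2)

lemma sum_advect:
  assumes "z \<in> D"
  shows "(\<Sum>i\<le>8. advect T (vel i) (f n i) z) = divergence n z"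
proof -
  have "d_space T a (\<lambda>q. \<Sum>i\<le>8. vel i $ a * f n i q) z = (\<Sum>i\<le>8. vel i $ a * d_space T a (f n i) z)" for a
    by (rule d_space_sum) (use assms f_smooth in auto)
  then show ?thesis
    by (simp add: divergence_def advect_def mom_nth sum.swap[of _ UNIV])
qed

lemma sum_vel_advect:
  assumes "\<And>i. i \<le> 8 \<Longrightarrow> sm (g i)" "z \<in> D"
  shows "(\<Sum>i\<le>8. vel i $ a * advect T (vel i) (g i) z)
    = (\<Sum>b\<in>UNIV. d_space T b (\<lambda>p. \<Sum>i\<le>8. vel i $ a * vel i $ b * g i p) z)"
proof -
  have "d_space T b (\<lambda>p. \<Sum>i\<le>8. vel i $ a * vel i $ b * g i p) z
      = (\<Sum>i\<le>8. vel i $ a * vel i $ b * d_space T b (g i) z)" for b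
    by (rule d_space_sum) (use assms in auto)
  then show ?thesis
    by (simp add: advect_def sum.swap[of _ UNIV] sum_distrib_left mult.assoc)
qed

lemma advect_vel_mom: "z \<in> D \<Longrightarrow> advect T (vel i) (\<lambda>p. vel i \<bullet> mom f n p) z
    = contract (strain T f n z) (vel_tensor i) / 2"
  unfolding advect_def inner_vec_def inner_real_def
  by (simp only: d_space_sum sm_mom) (simp add: contract_vel_tensor strain_nth sum_2 algebra_simps)

lemma streaming_1_Suc: "str 1 (Suc n) i z = advect T (vel i) (f n i) z + str 2 (Suc n) i z"
  using streaming_Suc[of 1 "Suc n" T f i z] by (simp add: D_op_1 eval_nat_numeral)

lemma streaming_1_Suc_Suc: "str 1 (Suc (Suc n)) i z =
    advect T (vel i) (f (Suc n) i) z + D_op T i 2 (f n i) z + str 3 (Suc (Suc n)) i z"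
  using streaming_Suc[of 2 "Suc (Suc n)" T f i z]
  by (simp add: streaming_1_Suc[unfolded One_nat_def] eval_nat_numeral)

text \<open>Because \<open>f 0 i\<close> is constant. In the first model this removes, from the
  equation of order k, the coefficient of \<tau> that contains the strain of order k.\<close>

lemma streaming_1_1: "i \<le> 8 \<Longrightarrow> z \<in> D \<Longrightarrow> str 1 1 i z = 0"
  using advect_cong[of "f 0 i" "\<lambda>_. weight i" z "vel i"]
  by (simp add: streaming_def D_op_1 f_zero advect_const)

lemma D_op_2_f_0: "i \<le> 8 \<Longrightarrow> z \<in> D \<Longrightarrow> D_op T i 2 (f 0 i) z = 0"
  using D_op_cong[of "f 0 i" "\<lambda>_. weight i" z i 2] by (simp add: f_zero D_op_2_const)

lemma streaming_1_2: "i \<le> 8 \<Longrightarrow> z \<in> D \<Longrightarrow> str 1 2 i z = advect T (vel i) (f 1 i) z"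
  using streaming_1_Suc_Suc[of 0 i z] D_op_2_f_0[of i z] by (simp add: streaming_def eval_nat_numeral)

lemma advect_opp_sum:
  assumes "i \<le> 8" "z \<in> D"
  shows "advect T (vel i) (f n i) z + advect T (vel (opp i)) (f n (opp i)) z
    = advect T (vel i) (\<lambda>p. f n i p - f n (opp i) p) z"
    and "advect T (vel i) (f n i) z - advect T (vel (opp i)) (f n (opp i)) z
    = advect T (vel i) (\<lambda>p. f n i p + f n (opp i) p) z"
  using assms advect_add[of "f n i" "\<lambda>p. - 1 * f n (opp i) p" z "vel i"]
  by (simp_all add: advect_add f_smooth opp_le vel_opp advect_uminus sm_mult[OF sm_const, of _ "-1", simplified]
      advect_cmult[of _ _ _ "-1", simplified])

text \<open>An odd part 3 w c.v is turned into a strain: c.\<nabla> (c.v) sees only the symmetric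
  part of the velocity gradient.\<close>

lemma advect_opp_sum_mom:
  assumes "\<And>z. z \<in> D \<Longrightarrow> f n i z - f n (opp i) z = 6 * weight i * (vel i \<bullet> mom f n z)"
    and i: "i \<le> 8" and z: "z \<in> D"
  shows "advect T (vel i) (f n i) z + advect T (vel (opp i)) (f n (opp i)) z
    = 3 * weight i * contract (strain T f n z) (vel_tensor i)"
proof -
  have "advect T (vel i) (f n i) z + advect T (vel (opp i)) (f n (opp i)) z
      = advect T (vel i) (\<lambda>p. (6 * weight i) * (vel i \<bullet> mom f n p)) z"
    unfolding advect_opp_sum(1)[OF i z] by (rule advect_cong) (use assms in auto)
  also have "\<dots> = 6 * weight i * advect T (vel i) (\<lambda>p. vel i \<bullet> mom f n p) z"
    unfolding inner_vec_def inner_real_def by (intro advect_cmult sm_intros sm_mom z)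
  finally show ?thesis
    by (simp add: advect_vel_mom z)
qed

end

locale lattice_model = lattice_expansion +
  fixes \<mu> :: "real \<Rightarrow> real"
  assumes mu_nonneg: "\<And>I. I \<ge> 0 \<Longrightarrow> \<mu> I \<ge> 0"

section \<open>The hydrodynamic induction\<close>

lemma contract_cauchy_schwarz: "(contract A B)\<^sup>2 \<le> contract A A * contract B B"
proof -
  have eq: "contract A B = A \<bullet> B" for A B :: "real^2^2"
    by (simp add: contract_def inner_vec_def)
  show ?thesis unfolding eq by (rule Cauchy_Schwarz_ineq)
qed

lemma contract_self_nonneg: "0 \<le> contract A A"
  by (simp add: contract_def sum_nonneg)

text \<open>\<open>A\<close> is the leading strain and \<open>B\<close> its perturbation. For
  negative \<open>m'\<close> the worst case is \<open>B\<close> parallel to \<open>A\<close>, and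
  there the expression is the hypothesis at I = A:A times B:B.\<close>

lemma viscosity_nonneg:
  assumes "0 \<le> m" "0 \<le> m + 2 * min m' 0 * contract A A"
  shows "0 \<le> m * contract B B + 2 * m' * (contract A B)\<^sup>2"
proof (cases "0 \<le> m'")
  case True
  then show ?thesis
    by (intro add_nonneg_nonneg mult_nonneg_nonneg assms(1) contract_self_nonneg) simp_all
next
  case False
  have "0 \<le> (m + 2 * m' * contract A A) * contract B B"
    using assms False by (intro mult_nonneg_nonneg contract_self_nonneg) simp
  also have "\<dots> = m * contract B B + 2 * (m' * (contract A A * contract B B))"
    by (simp add: algebra_simps)
  also have "\<dots> \<le> m * contract B B + 2 * (m' * (contract A B)\<^sup>2)"
    using mult_left_mono_neg[OF contract_cauchy_schwarz, of m' A B] False by simp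
  finally show ?thesis by simp
qed

text \<open>What the induction uses of either collision term. The second one contributes a multiple \<open>\<kappa> < 1\<close> of the
  divergence to the mass balance, because its additional term has the trace of the strain as mass.\<close>

locale lattice_hydrodynamics = lattice_model +
  assumes mu_cond: "\<And>I. I \<ge> 0 \<Longrightarrow> \<mu> I + 2 * min (dir_deriv {0..} 1 \<mu> I) 0 * I \<ge> 0"
    and init_rho: "\<And>k x. rho f (2 * k + 1) (x, 0) = 0"
    and init_mom: "\<And>k x. mom f (2 * k) (x, 0) = 0"
    and order_odd: "\<And>k i z. \<lbrakk>odd k; \<And>m. m < k \<Longrightarrow> symmetric m; i \<le> 8; z \<in> D\<rbrakk> \<Longrightarrow>
      f k i z + f k (opp i) z = 2 * weight i * rho f k z"
    and order_even: "\<And>k i z. \<lbrakk>even k; \<And>m. m < k \<Longrightarrow> symmetric m; i \<le> 8; z \<in> D\<rbrakk> \<Longrightarrow>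
      f k i z - f k (opp i) z = 6 * weight i * (vel i \<bullet> mom f k z)"
    and momentum_balance: "\<And>n a z. z \<in> D \<Longrightarrow> (\<Sum>i\<le>8. vel i $ a * str 1 n i z) = 0"
    and mass_balance_2: "\<And>z. z \<in> D \<Longrightarrow> \<exists>\<kappa><1. (\<Sum>i\<le>8. str 1 2 i z) = \<kappa> * divergence 1 z"
    and mass_balance: "\<And>k z. \<lbrakk>odd k; \<And>m. m < k \<Longrightarrow> symmetric m; divergence 1 z = 0; z \<in> D\<rbrakk> \<Longrightarrow>
      \<exists>\<kappa><1. (\<Sum>i\<le>8. str 1 (k + 2) i z) = \<kappa> * divergence (k + 1) z"
    and next_order_even: "\<And>k i z. \<lbrakk>even k; 2 \<le> k; \<And>m. m < k \<Longrightarrow> symmetric m; i \<le> 8; z \<in> D\<rbrakk> \<Longrightarrow>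
      f (k + 1) i z + f (k + 1) (opp i) z
      = 2 * weight i * rho f (k + 1) z + 4 * f_quad i (mom f 1 z) (mom f k z)
        - weight i * ((9 * \<mu> (contract (strain T f 1 z) (strain T f 1 z)) + 3/2)
              * contract (strain T f k z) (vel_tensor i)
            + 18 * dir_deriv {0..} 1 \<mu> (contract (strain T f 1 z) (strain T f 1 z))
              * contract (strain T f 1 z) (strain T f k z) * contract (strain T f 1 z) (vel_tensor i))"
begin

text \<open>At order 2 only the first-order operator acts nontrivially, so the streamed mass is the
  divergence itself, and \<kappa> < 1 forces it to vanish.\<close>

lemma divergence_1:
  assumes "z \<in> D"
  shows "divergence 1 z = 0"
proof -
  from mass_balance_2[OF assms] obtain \<kappa> where \<kappa>: "\<kappa> < 1" "(\<Sum>i\<le>8. str 1 2 i z) = \<kappa> * divergence 1 z"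
    by blast
  have "(\<Sum>i\<le>8. str 1 2 i z) = divergence 1 z"
    using assms by (simp add: streaming_1_2[unfolded One_nat_def] flip: sum_advect)
  with \<kappa> show ?thesis by simp
qed

text \<open>The second conclusion concerns the next order: it provides the incompressibility that
  the even step requires.\<close>

lemma odd_step:
  assumes k: "odd k" and sym: "\<And>m. m < k \<Longrightarrow> symmetric m"
  shows "symmetric k" and "z \<in> D \<Longrightarrow> divergence (k + 1) z = 0"
proof -
  let ?\<rho> = "rho f k"
  have even_part: "f k i z + f k (opp i) z = (2 * weight i) * ?\<rho> z" if "i \<le> 8" "z \<in> D" for i z
    using order_odd[OF k sym that] .
  have advect_pair: "advect T (vel i) (f k i) z - advect T (vel (opp i)) (f k (opp i)) z
      = 2 * weight i * advect T (vel i) ?\<rho> z" if i: "i \<le> 8" and z: "z \<in> D" for i z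
    unfolding advect_opp_sum(2)[OF i z]
    by (subst advect_cong[where h = "\<lambda>p. (2 * weight i) * ?\<rho> p"])
      (simp_all only: even_part i z advect_cmult sm_rho)
  have grad0: "d_space T a ?\<rho> z = 0" if z: "z \<in> D" for a z
  proof -
    \<comment> \<open>\<open>str 2 (Suc k)\<close> contains only orders below \<open>k\<close>,
      hence is even in the direction because \<open>Suc k\<close> is even.\<close>
    have "(\<Sum>i\<le>8. vel i $ a * str 2 (Suc k) i z) = 0"
      by (rule sum_odd_eq_0) (use k z in \<open>simp add: vel_opp streaming_symmetric sym\<close>)
    then have "0 = (\<Sum>i\<le>8. vel i $ a * advect T (vel i) (f k i) z)"
      using momentum_balance[OF z, of a "Suc k"]
      by (simp add: streaming_1_Suc[unfolded One_nat_def] distrib_left sum.distrib)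
    also have "\<dots> = (\<Sum>i\<le>8. weight i * (vel i $ a * advect T (vel i) ?\<rho> z))"
    proof (subst sum_even_part, intro sum.cong refl)
      fix i :: nat assume "i \<in> {..8}"
      then have i: "i \<le> 8" by simp
      have "(vel i $ a * advect T (vel i) (f k i) z + vel (opp i) $ a * advect T (vel (opp i)) (f k (opp i)) z) / 2
          = vel i $ a * (advect T (vel i) (f k i) z - advect T (vel (opp i)) (f k (opp i)) z) / 2"
        by (simp add: vel_opp i algebra_simps)
      then show "(vel i $ a * advect T (vel i) (f k i) z + vel (opp i) $ a * advect T (vel (opp i)) (f k (opp i)) z) / 2
          = weight i * (vel i $ a * advect T (vel i) ?\<rho> z)"
        unfolding advect_pair[OF i z] by simp
    qed
    also have "\<dots> = (\<Sum>b\<in>UNIV. d_space T b ?\<rho> z * (\<Sum>i\<le>8. weight i * (vel i $ a * vel i $ b)))"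
      by (simp add: advect_def sum_distrib_left sum.swap[of _ "{..8}"] mult_ac)
    also have "\<dots> = d_space T a ?\<rho> z / 3"
      by (simp add: sum_weight_vel_vel if_distrib[of "(*) _"] cong: if_cong)
    finally show ?thesis by simp
  qed
  have advect0: "advect T c ?\<rho> z = 0" if "z \<in> D" for c z
    using that by (simp add: advect_def grad0)
  \<comment> \<open>The balance of order \<open>k + 2\<close>. The coefficient of order
    \<open>k + 1\<close> enters only through its divergence, that of order \<open>k\<close> only
    through the density.\<close>
  have mass: "\<exists>\<kappa><1. divergence (k + 1) z + d_time T ?\<rho> z = \<kappa> * divergence (k + 1) z" if z: "z \<in> D" for z
  proof -
    have "D_op T i 2 (f k i) z + D_op T (opp i) 2 (f k (opp i)) z = 2 * (weight i * d_time T ?\<rho> z)"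
      if i: "i \<le> 8" for i
    proof -
      have "D_op T i 2 (f k i) z + D_op T (opp i) 2 (f k (opp i)) z
          = D_op T i 2 (f k i) z + D_op T i 2 (f k (opp i)) z"
        using i z by (simp add: D_op_opp f_smooth opp_le)
      also have "\<dots> = D_op T i 2 (\<lambda>p. f k i p + f k (opp i) p) z"
        using i z advect_cong[of "advect T (vel i) (\<lambda>p. f k i p + f k (opp i) p)"
            "\<lambda>p. advect T (vel i) (f k i) p + advect T (vel i) (f k (opp i)) p" z "vel i"]
        by (simp add: D_op_2 d_time_add advect_add f_smooth opp_le sm_advect field_simps)
      also have "\<dots> = D_op T i 2 (\<lambda>p. (2 * weight i) * ?\<rho> p) z"
        using i z by (intro D_op_cong even_part)
      also have "\<dots> = 2 * weight i * D_op T i 2 ?\<rho> z"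
        using z by (intro D_op_cmult sm_rho)
      also have "\<dots> = 2 * (weight i * d_time T ?\<rho> z)"
        using z advect_cong[of "advect T (vel i) ?\<rho>" "\<lambda>p. 0" z "vel i"]
        by (simp add: D_op_2 advect0 advect_const)
      finally show ?thesis .
    qed
    then have "(\<Sum>i\<le>8. D_op T i 2 (f k i) z) = (\<Sum>i\<le>8. weight i * d_time T ?\<rho> z)"
      by (subst sum_even_part) simp
    moreover have "(\<Sum>i\<le>8. weight i) = 1"
      by (simp add: sum_atMost_8 weight_simps)
    moreover have "(\<Sum>i\<le>8. str 3 (Suc (Suc k)) i z) = 0"
      by (rule sum_odd_eq_0) (use k z in \<open>simp add: streaming_symmetric sym\<close>)
    ultimately have "(\<Sum>i\<le>8. str 1 (k + 2) i z) = divergence (k + 1) z + d_time T ?\<rho> z"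
      using sum_advect[OF z, of "Suc k"]
      by (simp add: streaming_1_Suc_Suc[unfolded One_nat_def] sum.distrib flip: sum_distrib_right)
    then show ?thesis
      using mass_balance[OF k sym divergence_1[OF z] z] by simp
  qed
  have zero: "divergence (k + 1) z = 0 \<and> d_time T ?\<rho> z = 0" if z: "z \<in> D" for z
  proof -
    obtain x t where zxt: "z = (x, t)" and t: "t \<in> {0..T}" using z by (auto simp: slab_def)
    define r where "r = d_time T ?\<rho> (x, t)"
    have r: "d_time T ?\<rho> (y, t) = r" for y
    proof -
      have "r = d_time T (\<lambda>p. ?\<rho> (p + (y - x, 0))) (x, t)"
        unfolding r_def
      proof (rule d_time_cong)
        fix q assume "q \<in> D"
        then show "?\<rho> q = ?\<rho> (q + (y - x, 0))"
          using constant_in_space[OF sm_rho _ grad0] by (cases q) (simp add: slab_iff)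
      qed (use z zxt in simp)
      also have "\<dots> = d_time T ?\<rho> (y, t)"
        unfolding d_time_def using z zxt by (subst dd_translate[OF sm_rho]) auto
      finally show ?thesis by simp
    qed
    let ?d = "\<lambda>a. d_space T a (\<lambda>q. mom f (k + 1) q $ a)"
    \<comment> \<open>\<kappa> varies from point to point, so the balance cannot be integrated as it
      stands. The divergence times the spatial constant \<open>- r\<close> has zero integral, and
      \<open>r = (\<kappa> - 1) * divergence\<close> makes it nonnegative.\<close>
    define g where "g = (\<lambda>p. (- r) * (?d 1 p + ?d 2 p))"
    have g: "g p = - r * divergence (k + 1) p" for p
      by (simp add: g_def divergence_def sum_2)
    have smd: "sm (?d a)" for a by (intro sm_intros sm_mom)
    have cont: "continuous_on D g"
      unfolding g_def by (intro smooth_on_continuous sm_intros sm_mom)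
    have \<kappa>: "\<exists>\<kappa><1. g (y, t) = (1 - \<kappa>) * (divergence (k + 1) (y, t))\<^sup>2" for y
    proof -
      have "(y, t) \<in> D" using t by (simp add: slab_iff)
      from mass[OF this] obtain \<kappa> where "\<kappa> < 1" "divergence (k + 1) (y, t) + r = \<kappa> * divergence (k + 1) (y, t)"
        unfolding r by blast
      moreover from this have "r = (\<kappa> - 1) * divergence (k + 1) (y, t)"
        by (simp add: algebra_simps)
      ultimately show ?thesis
        by (intro exI[of _ \<kappa>]) (simp only: g, simp add: power2_eq_square algebra_simps)
    qed
    have "cell_integral L x g t = 0"
      unfolding g_def
      by (simp only: cell_integral_cmult cell_integral_add smooth_on_continuous smd t)
        (simp add: cell_integral_space_deriv[OF sm_mom per_mom t])
    moreover have "0 \<le> g (y, t)" for y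
      using \<kappa>[of y] by auto
    ultimately have "g (x, t) = 0"
      using cell_integral_eq_0_imp[OF cont t] by blast
    with \<kappa>[of x] have "divergence (k + 1) z = 0" by (auto simp: zxt)
    with mass[OF z] show ?thesis by auto
  qed
  show "z \<in> D \<Longrightarrow> divergence (k + 1) z = 0" using zero by blast
  have "?\<rho> (x, t) = 0" if t: "t \<in> {0..T}" for x t
  proof -
    have "((\<lambda>t. ?\<rho> (x, t)) has_derivative (\<lambda>_. 0)) (at s within {0..T})" if "s \<in> {0..T}" for s
      using has_vector_derivative_time[OF sm_rho that, of k x] zero[of "(x, s)"] that
      by (simp add: has_vector_derivative_def slab_iff)
    from has_derivative_zero_unique[OF _ this, of t 0] have "?\<rho> (x, t) = ?\<rho> (x, 0)"
      using t by auto
    then show ?thesis using k init_rho by (auto elim!: oddE)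
  qed
  then have "?\<rho> z = 0" if "z \<in> D" for z
    using that by (auto simp: slab_def)
  with even_part k show "symmetric k"
    unfolding symmetric_def by fastforce
qed

text \<open>The momentum balance of order \<open>k + 2\<close> is an evolution equation for
  \<open>mom f k\<close> to which \<open>energy_zero\<close> applies, with the leading velocity
  \<open>mom f 1\<close> as \<open>u\<close>.\<close>

lemma even_step:
  assumes k: "even k" "2 \<le> k" and sym: "\<And>m. m < k \<Longrightarrow> symmetric m"
    and div: "\<And>z. z \<in> D \<Longrightarrow> divergence k z = 0"
  shows "symmetric k"
proof -
  define Q where "Q a b = (\<lambda>p. \<Sum>i\<le>8. vel i $ a * vel i $ b * advect T (vel i) (f k i) p)" for a b
  define P where "P a b = (\<lambda>p. \<Sum>i\<le>8. vel i $ a * vel i $ b * f (k + 1) i p)" for a b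
  \<comment> \<open>The momentum flux; its half of \<open>Q\<close> comes from the second-order term of the Taylor expansion and
    cancels the \<open>1/2\<close> in \<open>\<tau> = 3 \<mu> + 1/2\<close>.\<close>
  define R where "R a b = (\<lambda>p. P a b p + 1/2 * Q a b p)" for a b
  \<comment> \<open>Regularity and periodicity of \<open>R\<close> are inherited from
    \<open>f\<close>; the closed form \<open>R_eq\<close> is used only pointwise, so it never has to
    be differentiated.\<close>
  have smQ: "sm (Q a b)" and smP: "sm (P a b)" and perR: "per (R a b)" for a b
    unfolding R_def P_def Q_def by (intro sm_intros per_intros f_smooth f_periodic; simp)+
  then have smR: "sm (R a b)" for a b
    unfolding R_def by (intro sm_intros)
  have odd_part: "f k i z - f k (opp i) z = (6 * weight i) * (vel i \<bullet> mom f k z)"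
    if "i \<le> 8" "z \<in> D" for i z
    using order_even[OF k(1) sym that] by simp
  have evol: "d_time T (\<lambda>z. mom f k z $ a) z + (\<Sum>b\<in>UNIV. d_space T b (R a b) z) = 0" if z: "z \<in> D" for a z
  proof -
    have t3: "(\<Sum>i\<le>8. vel i $ a * str 3 (Suc (Suc k)) i z) = 0"
      by (rule sum_odd_eq_0) (use k z in \<open>simp add: vel_opp streaming_symmetric sym\<close>)
    have t1: "(\<Sum>i\<le>8. vel i $ a * advect T (vel i) (f (Suc k) i) z) = (\<Sum>b\<in>UNIV. d_space T b (P a b) z)"
      unfolding P_def using z by (simp add: sum_vel_advect f_smooth)
    have "d_time T (\<lambda>z. mom f k z $ a) z = (\<Sum>i\<le>8. vel i $ a * d_time T (f k i) z)"
      unfolding mom_nth by (rule d_time_sum) (use z f_smooth in auto)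
    moreover have "(\<Sum>i\<le>8. vel i $ a * advect T (vel i) (advect T (vel i) (f k i)) z)
        = (\<Sum>b\<in>UNIV. d_space T b (Q a b) z)"
      unfolding Q_def using z by (simp add: sum_vel_advect sm_advect f_smooth)
    ultimately have t2: "(\<Sum>i\<le>8. vel i $ a * D_op T i 2 (f k i) z)
        = d_time T (\<lambda>z. mom f k z $ a) z + 1/2 * (\<Sum>b\<in>UNIV. d_space T b (Q a b) z)"
      by (simp add: D_op_2 distrib_left sum.distrib flip: sum_divide_distrib)
    have "d_space T b (R a b) z = d_space T b (P a b) z + 1/2 * d_space T b (Q a b) z" for b
      unfolding R_def using z
      by (simp only: d_space_add[OF _ _ z] d_space_mult[OF _ _ z] d_space_const[OF z] sm_intros smP smQ mult_zero_left add_0_right)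
    then have "(\<Sum>b\<in>UNIV. d_space T b (R a b) z)
        = (\<Sum>b\<in>UNIV. d_space T b (P a b) z) + 1/2 * (\<Sum>b\<in>UNIV. d_space T b (Q a b) z)"
      by (simp only: sum.distrib sum_distrib_left)
    then show ?thesis
      using momentum_balance[OF z, of a "Suc (Suc k)"] t1 t2 t3
      by (simp add: streaming_1_Suc_Suc[unfolded One_nat_def] distrib_left sum.distrib)
  qed
  have Q_eq: "Q a b z = strain T f k z $ a $ b / 3" if z: "z \<in> D" for a b z
  proof -
    have "Q a b z = (\<Sum>i\<le>8. 3/2 * (weight i * (vel i $ a * vel i $ b * contract (strain T f k z) (vel_tensor i))))"
      unfolding Q_def
    proof (subst sum_even_part, intro sum.cong refl)
      fix i :: nat assume "i \<in> {..8}"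
      then have i: "i \<le> 8" by simp
      have "advect T (vel i) (f k i) z + advect T (vel (opp i)) (f k (opp i)) z
          = 3 * weight i * contract (strain T f k z) (vel_tensor i)"
        using odd_part i z by (intro advect_opp_sum_mom)
      then have "vel i $ a * vel i $ b * (advect T (vel i) (f k i) z + advect T (vel (opp i)) (f k (opp i)) z)
          = vel i $ a * vel i $ b * (3 * (weight i * contract (strain T f k z) (vel_tensor i)))"
        by simp
      then show "(vel i $ a * vel i $ b * advect T (vel i) (f k i) z
          + vel (opp i) $ a * vel (opp i) $ b * advect T (vel (opp i)) (f k (opp i)) z) / 2
        = 3/2 * (weight i * (vel i $ a * vel i $ b * contract (strain T f k z) (vel_tensor i)))"
        by (simp add: vel_opp i algebra_simps)
    qed
    also have "\<dots> = 3/2 * (2/9 * strain T f k z $ a $ b)"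
      unfolding sum_distrib_left[symmetric] using trace_strain[of k z] div[OF z]
      by (subst sum_weight_vel_vel_tensor) (simp_all add: strain_sym[of T f k z 1 2])
    finally show ?thesis by simp
  qed
  define m where "m z = \<mu> (contract (strain T f 1 z) (strain T f 1 z))" for z
  define m' where "m' z = dir_deriv {0..} 1 \<mu> (contract (strain T f 1 z) (strain T f 1 z))" for z
  \<comment> \<open>The stress in \<open>P\<close> has the factor (9 \<mu> + 3/2)/2 * 2/9 = \<mu> +
    1/6, and half of \<open>Q\<close> returns the 1/6.\<close>
  have R_eq: "R a b z = (if a = b then rho f (k + 1) z / 3 else 0)
      + (mom f 1 z $ a * mom f k z $ b + mom f k z $ a * mom f 1 z $ b)
      - (m z * strain T f k z $ a $ b
         + 2 * m' z * contract (strain T f 1 z) (strain T f k z) * strain T f 1 z $ a $ b)"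
    if z: "z \<in> D" for a b z
  proof -
    have "P a b z = (\<Sum>i\<le>8. rho f (k + 1) z * (weight i * (vel i $ a * vel i $ b))
      + 2 * (vel i $ a * vel i $ b * f_quad i (mom f 1 z) (mom f k z))
      - (9 * m z + 3/2) / 2 * (weight i * (vel i $ a * vel i $ b * contract (strain T f k z) (vel_tensor i)))
      - 9 * m' z * contract (strain T f 1 z) (strain T f k z)
        * (weight i * (vel i $ a * vel i $ b * contract (strain T f 1 z) (vel_tensor i))))"
      unfolding P_def
    proof (subst sum_even_part, intro sum.cong refl)
      fix i :: nat assume "i \<in> {..8}"
      then have i: "i \<le> 8" by simp
      have "vel i $ a * vel i $ b * (f (k + 1) i z + f (k + 1) (opp i) z) / 2
         = rho f (k + 1) z * (weight i * (vel i $ a * vel i $ b))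
      + 2 * (vel i $ a * vel i $ b * f_quad i (mom f 1 z) (mom f k z))
      - (9 * m z + 3/2) / 2 * (weight i * (vel i $ a * vel i $ b * contract (strain T f k z) (vel_tensor i)))
      - 9 * m' z * contract (strain T f 1 z) (strain T f k z)
        * (weight i * (vel i $ a * vel i $ b * contract (strain T f 1 z) (vel_tensor i)))"
        using next_order_even[OF k sym i z]
        by (simp only: m_def m'_def) (simp add: field_simps)
      then show "(vel i $ a * vel i $ b * f (k + 1) i z + vel (opp i) $ a * vel (opp i) $ b * f (k + 1) (opp i) z) / 2
         = rho f (k + 1) z * (weight i * (vel i $ a * vel i $ b))
      + 2 * (vel i $ a * vel i $ b * f_quad i (mom f 1 z) (mom f k z))
      - (9 * m z + 3/2) / 2 * (weight i * (vel i $ a * vel i $ b * contract (strain T f k z) (vel_tensor i)))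
      - 9 * m' z * contract (strain T f 1 z) (strain T f k z)
        * (weight i * (vel i $ a * vel i $ b * contract (strain T f 1 z) (vel_tensor i)))"
        by (simp add: vel_opp i distrib_left)
    qed
    also have "\<dots> = rho f (k + 1) z * (if a = b then 1/3 else 0)
      + (mom f 1 z $ a * mom f k z $ b + mom f k z $ a * mom f 1 z $ b)
      - (9 * m z + 3/2) / 2 * (2/9 * strain T f k z $ a $ b)
      - 9 * m' z * contract (strain T f 1 z) (strain T f k z) * (2/9 * strain T f 1 z $ a $ b)"
    proof -
      have moment: "(\<Sum>i\<le>8. weight i * (vel i $ a * vel i $ b * contract (strain T f n z) (vel_tensor i)))
          = 2/9 * strain T f n z $ a $ b" if "divergence n z = 0" for n
        using that trace_strain[of n z]
        by (intro sum_weight_vel_vel_tensor) (auto simp: strain_sym[of T f n z 1 2])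
      show ?thesis
        by (simp only: sum.distrib sum_subtractf sum_weight_vel_vel sum_vel_vel_f_quad
            moment[OF div[OF z]] moment[OF divergence_1[OF z]] flip: sum_distrib_left) simp
    qed
    finally show ?thesis
      by (cases "a = b") (simp_all add: R_def Q_eq[OF z] field_simps)
  qed
  have dissip: "(\<Sum>a\<in>UNIV. \<Sum>b\<in>UNIV. d_space T b (\<lambda>z. mom f k z $ a) z * R a b z)
      \<le> (\<Sum>a\<in>UNIV. \<Sum>b\<in>UNIV. d_space T b (\<lambda>z. mom f k z $ a) z
          * (mom f 1 z $ a * mom f k z $ b + mom f k z $ a * mom f 1 z $ b))" if z: "z \<in> D" for z
  proof -
    let ?G = "\<lambda>a b. d_space T b (\<lambda>z. mom f k z $ a) z"
    \<comment> \<open>A symmetric matrix sees only the symmetric part of the velocity gradient,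
      which is half the strain. Below, the pressure multiplies the divergence and drops out.\<close>
    let ?c = "contract (strain T f 1 z) (strain T f k z)"
    have grad: "contract (strain T f n z) (strain T f k z) = 2 * (\<Sum>a\<in>UNIV. \<Sum>b\<in>UNIV. ?G a b * strain T f n z $ a $ b)" for n
      by (simp only: contract_def strain_nth[of k] sum_2 strain_sym[of T f n z 2 1]) algebra
    have "0 \<le> m z * contract (strain T f k z) (strain T f k z) + 2 * m' z * ?c\<^sup>2"
      unfolding m_def m'_def
      by (intro viscosity_nonneg mu_nonneg mu_cond contract_self_nonneg)
    moreover have "(\<Sum>a\<in>UNIV. \<Sum>b\<in>UNIV. ?G a b * R a b z)
      = rho f (k + 1) z / 3 * divergence k z
        + (\<Sum>a\<in>UNIV. \<Sum>b\<in>UNIV. ?G a b * (mom f 1 z $ a * mom f k z $ b + mom f k z $ a * mom f 1 z $ b))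
        - (m z * (\<Sum>a\<in>UNIV. \<Sum>b\<in>UNIV. ?G a b * strain T f k z $ a $ b)
           + 2 * m' z * ?c * (\<Sum>a\<in>UNIV. \<Sum>b\<in>UNIV. ?G a b * strain T f 1 z $ a $ b))"
      unfolding R_eq[OF z] divergence_def sum_2 by (simp add: algebra_simps)
    ultimately show ?thesis
      using grad[of k] grad[of 1] div[OF z] by (simp add: power2_eq_square)
  qed
  have init: "mom f k (x, 0) $ a = 0" for x a
    using init_mom[of "k div 2" x] k by simp
  have "mom f k z $ a = 0" if z: "z \<in> D" for a z
    by (rule energy_zero[where v = "\<lambda>a z. mom f k z $ a" and u = "\<lambda>a z. mom f 1 z $ a" and R = R,
          OF sm_mom per_mom sm_mom per_mom smR perR evol div[unfolded divergence_def]
          divergence_1[unfolded divergence_def] dissip init z])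
  then have "mom f k z = 0" if "z \<in> D" for z
    using that by (simp add: vec_eq_iff)
  with odd_part have "f k (opp i) z = f k i z" if "i \<le> 8" "z \<in> D" for i z
    using that by fastforce
  then show ?thesis
    using k unfolding symmetric_def by simp
qed

text \<open>Orders advance in pairs, because the odd step hands the vanishing divergence to the even
  step after it.\<close>

lemma all_symmetric: "symmetric k"
proof -
  have "(\<forall>m<2 * j + 1. symmetric m)" for j
  proof (induction j)
    case 0
    then show ?case by (simp add: symmetric_0)
  next
    case (Suc j)
    note o = odd_step[of "2 * j + 1"]
    have s1: "symmetric (2 * j + 1)" by (rule o(1)) (use Suc in auto)
    have d: "divergence (2 * j + 2) z = 0" if "z \<in> D" for z
      using Suc o(2)[OF _ _ that] by auto
    have lt: "symmetric m" if "m < 2 * j + 2" for m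
      using that s1 Suc by (cases "m = 2 * j + 1") auto
    have s2: "symmetric (2 * j + 2)" by (rule even_step[OF _ _ lt d]) simp_all
    show ?case
    proof (intro allI impI)
      fix m assume "m < 2 * Suc j + 1"
      then show "symmetric m" using lt s2 by (cases "m = 2 * j + 2") auto
    qed
  qed
  from this[of k] show ?thesis by simp
qed

end

section \<open>The two collision terms\<close>

lemma sum_antidiagonal:
  "(\<Sum>(p, q)\<in>{(p, q). p + q = k}. g p q) = (\<Sum>p\<le>(k::nat). g p (k - p))"
  by (rule sum.reindex_bij_witness[of _ "\<lambda>p. (p, k - p)" fst]) auto

lemma sum_antidiagonal_pos:
  "(\<Sum>(r, n)\<in>{(r, n). r + n = k \<and> 1 \<le> n}. g r n) = (\<Sum>n=1..(k::nat). g (k - n) n)"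
  by (rule sum.reindex_bij_witness[of _ "\<lambda>n. (k - n, n)" snd]) auto

lemma sum_antidiagonal_Suc:
  "(\<Sum>(a, b)\<in>{(a, b). a + b + 1 = k}. g a b) = (\<Sum>b<(k::nat). g (k - 1 - b) b)"
  by (rule sum.reindex_bij_witness[of _ "\<lambda>b. (k - 1 - b, b)" snd]) auto

text \<open>The factor \<open>1/\<tau>\<close> of the first collision term does not affect conservation.\<close>

lemma convolution_eq_0_imp:
  fixes F M :: "nat \<Rightarrow> real"
  assumes conv: "\<And>k. (\<Sum>n=1..k. F (k - n) * M n) = 0" and "F 0 \<noteq> 0" and "1 \<le> n"
  shows "M n = 0"
  using assms(3)
proof (induction n rule: less_induct)
  case (less n)
  have "(\<Sum>m=1..n. F (n - m) * M m) = (\<Sum>m\<in>{n}. F (n - m) * M m)"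
    by (rule sum.mono_neutral_right) (use less in auto)
  with conv[of n] assms(2) show ?case by simp
qed

context lattice_model
begin

definition collision :: "nat \<Rightarrow> nat \<Rightarrow> (real^2) \<times> real \<Rightarrow> real"
  where "collision k i z = - f k i z + f_lin i (rho f k z) (mom f k z)
    + (\<Sum>p\<le>k. f_quad i (mom f p z) (mom f (k - p) z))"

lemma sum_collision: "(\<Sum>i\<le>8. collision k i z) = 0"
proof -
  have "(\<Sum>i\<le>8. \<Sum>p\<le>k. f_quad i (mom f p z) (mom f (k - p) z)) = 0"
    by (subst sum.swap) (simp add: sum_f_quad)
  then show ?thesis
    by (simp add: collision_def sum.distrib sum_subtractf sum_f_lin) (simp add: rho_def)
qed

lemma sum_vel_collision: "(\<Sum>i\<le>8. vel i $ a * collision k i z) = 0"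
proof -
  have "(\<Sum>i\<le>8. \<Sum>p\<le>k. vel i $ a * f_quad i (mom f p z) (mom f (k - p) z)) = 0"
    by (subst sum.swap) (simp add: sum_vel_f_quad)
  then show ?thesis
    by (simp add: collision_def sum.distrib sum_subtractf distrib_left right_diff_distrib sum_distrib_left
        sum_vel_f_lin) (simp add: mom_nth)
qed

lemma collision_diff: "i \<le> 8 \<Longrightarrow> collision k i z - collision k (opp i) z
    = - (f k i z - f k (opp i) z) + 6 * weight i * (vel i \<bullet> mom f k z)"
  by (simp add: collision_def f_lin_def f_quad_opp weight_opp vel_opp algebra_simps)

lemma collision_sum: "i \<le> 8 \<Longrightarrow> collision k i z + collision k (opp i) z
    = - (f k i z + f k (opp i) z) + 2 * weight i * rho f k z
      + 2 * (\<Sum>p\<le>k. f_quad i (mom f p z) (mom f (k - p) z))"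
  by (simp add: collision_def f_lin_def f_quad_opp weight_opp vel_opp algebra_simps)

text \<open>One of \<open>p\<close> and \<open>k - p\<close> is even and therefore smaller than the
  odd \<open>k\<close>, so its momentum vanishes.\<close>

lemma sum_f_quad_odd:
  assumes "odd k" "\<And>m. m < k \<Longrightarrow> symmetric m" "z \<in> D"
  shows "(\<Sum>p\<le>k. f_quad i (mom f p z) (mom f (k - p) z)) = 0"
proof (intro sum.neutral ballI)
  fix p assume "p \<in> {..k}"
  then have "even p \<and> p < k \<or> even (k - p) \<and> k - p < k"
    using assms(1) by (cases "even p") (auto simp: le_less odd_pos)
  then show "f_quad i (mom f p z) (mom f (k - p) z) = 0"
    using assms(2,3) mom_symmetric f_quad_0 by metis
qed

text \<open>The even index of each pair has vanishing momentum unless it is \<open>k\<close>, whose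
  partner is 1. \<open>2 \<le> k\<close> keeps the two surviving terms distinct.\<close>

lemma sum_f_quad_next:
  assumes "even k" "2 \<le> k" "\<And>m. m < k \<Longrightarrow> symmetric m" "z \<in> D"
  shows "(\<Sum>p\<le>k + 1. f_quad i (mom f p z) (mom f (k + 1 - p) z)) = 2 * f_quad i (mom f 1 z) (mom f k z)"
proof -
  have "(\<Sum>p\<le>k + 1. f_quad i (mom f p z) (mom f (k + 1 - p) z))
      = (\<Sum>p\<in>{1, k}. f_quad i (mom f p z) (mom f (k + 1 - p) z))"
  proof (intro sum.mono_neutral_right ballI)
    fix p assume p: "p \<in> {..k + 1} - {1, k}"
    then have "even p \<and> p < k \<or> even (k + 1 - p) \<and> k + 1 - p < k"
      using assms(1,2) by (cases "even p") (auto simp: le_less elim!: oddE)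
    then show "f_quad i (mom f p z) (mom f (k + 1 - p) z) = 0"
      using assms(3,4) mom_symmetric f_quad_0 by metis
  qed (use assms(2) in auto)
  then show ?thesis
    using assms(2) by (simp add: f_quad_sym[of i "mom f k z"])
qed

lemma divergence_symmetric: "\<lbrakk>symmetric n; even n; z \<in> D\<rbrakk> \<Longrightarrow> divergence n z = 0"
  using trace_strain[of n z] by (simp add: strain_symmetric)

lemma mu_series_odd_eq_0:
  assumes "odd N" "\<And>m. m \<le> Suc N \<Longrightarrow> symmetric m" "z \<in> D"
  shows "fps_nth (mu_series \<mu> T f z) N = 0"
  using assms by (intro mu_series_odd_nth_eq_0 strain_symmetric) auto

lemma mu_series_top:
  assumes "even k" "2 \<le> k" "\<And>m. m < k \<Longrightarrow> symmetric m" "z \<in> D"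
  shows "fps_nth (mu_series \<mu> T f z) (k - 1)
    = 2 * dir_deriv {0..} 1 \<mu> (contract (strain T f 1 z) (strain T f 1 z))
      * contract (strain T f 1 z) (strain T f k z)"
  using assms mu_series_odd_nth[of "k - 1" T f z \<mu>] strain_symmetric by simp

lemma mu_nonneg': "0 \<le> \<mu> (contract (strain T f 1 z) (strain T f 1 z))"
  by (intro mu_nonneg contract_self_nonneg)

end

section \<open>First collision term: shear-dependent relaxation time\<close>

locale first_model = lattice_model +
  assumes solves: "solves_first_model \<mu> T f"
begin

abbreviation "F \<equiv> F_coeff \<mu> T f"

lemma hierarchy: "i \<le> 8 \<Longrightarrow> z \<in> D \<Longrightarrow> (\<Sum>n=1..k. F (k - n) z * str 1 n i z) = collision k i z"
  using solves unfolding solves_first_model_def sum_antidiagonal_pos sum_antidiagonal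
  by (simp add: collision_def streaming_def)

lemma F_0: "F 0 z = 3 * \<mu> (contract (strain T f 1 z) (strain T f 1 z)) + 1/2"
  by (simp add: F_coeff_def mu_series_nth_0)

lemma F_odd: "odd N \<Longrightarrow> F N z = 3 * fps_nth (mu_series \<mu> T f z) N"
  using odd_pos[of N] by (simp add: F_coeff_def)

lemma F_odd_eq_0: "\<lbrakk>odd N; \<And>m. m \<le> Suc N \<Longrightarrow> symmetric m; z \<in> D\<rbrakk> \<Longrightarrow> F N z = 0"
  by (simp add: F_odd mu_series_odd_eq_0)

lemma F_0_nonzero: "F 0 z \<noteq> 0"
  using mu_nonneg'[of z] by (simp add: F_0)

text \<open>\<open>F\<close> does not depend on the direction, so moments commute with the
  convolution; as \<open>F 0 z\<close> is nonzero, conservation by the collision passes to every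
  streaming order.\<close>

lemma mass_balance_all:
  assumes z: "z \<in> D" and n: "1 \<le> n"
  shows "(\<Sum>i\<le>8. str 1 n i z) = 0"
proof (rule convolution_eq_0_imp[where F = "\<lambda>r. F r z", OF _ F_0_nonzero n])
  fix k
  have "(\<Sum>n=1..k. F (k - n) z * (\<Sum>i\<le>8. str 1 n i z)) = (\<Sum>i\<le>8. \<Sum>n=1..k. F (k - n) z * str 1 n i z)"
    by (simp add: sum_distrib_left sum.swap[of _ "{..8}"])
  also have "\<dots> = (\<Sum>i\<le>8. collision k i z)"
    using z by (intro sum.cong hierarchy) auto
  finally show "(\<Sum>n=1..k. F (k - n) z * (\<Sum>i\<le>8. str 1 n i z)) = 0"
    by (simp add: sum_collision)
qed

lemma momentum_balance_all:
  assumes z: "z \<in> D"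
  shows "(\<Sum>i\<le>8. vel i $ a * str 1 n i z) = 0"
proof (cases "n = 0")
  case False
  then have "1 \<le> n" by simp
  then show ?thesis
  proof (rule convolution_eq_0_imp[where F = "\<lambda>r. F r z" and M = "\<lambda>n. \<Sum>i\<le>8. vel i $ a * str 1 n i z",
        rotated 2])
    fix k
    have "(\<Sum>n=1..k. F (k - n) z * (\<Sum>i\<le>8. vel i $ a * str 1 n i z))
        = (\<Sum>i\<le>8. vel i $ a * (\<Sum>n=1..k. F (k - n) z * str 1 n i z))"
      by (simp add: sum_distrib_left sum.swap[of _ "{..8}"] mult.left_commute)
    also have "\<dots> = (\<Sum>i\<le>8. vel i $ a * collision k i z)"
      using z by (intro sum.cong) (auto simp: hierarchy[unfolded One_nat_def])
    finally show "(\<Sum>n=1..k. F (k - n) z * (\<Sum>i\<le>8. vel i $ a * str 1 n i z)) = 0"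
      by (simp add: sum_vel_collision)
  qed (rule F_0_nonzero)
qed (simp add: streaming_def)

lemma order_odd_first:
  assumes k: "odd k" and sym: "\<And>m. m < k \<Longrightarrow> symmetric m" and i: "i \<le> 8" and z: "z \<in> D"
  shows "f k i z + f k (opp i) z = 2 * weight i * rho f k z"
proof -
  have "(\<Sum>n=1..k. F (k - n) z * (str 1 n i z + str 1 n (opp i) z)) = 0"
  proof (intro sum.neutral ballI)
    fix n assume n: "n \<in> {1..k}"
    show "F (k - n) z * (str 1 n i z + str 1 n (opp i) z) = 0"
    proof (cases "even n")
      case True
      \<comment> \<open>The odd index \<open>k - n\<close> reaches the strain of order
        \<open>k - n + 1\<close>, which lies below \<open>k\<close> because an even \<open>n\<close>
        is at least 2.\<close>
      have "F (k - n) z = 0"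
        by (rule F_odd_eq_0) (use True n k sym z in \<open>auto elim!: evenE oddE\<close>)
      then show ?thesis by simp
    next
      case False
      have "str 1 n (opp i) z = (-1) ^ n * str 1 n i z"
        by (rule streaming_symmetric) (use n sym i z in auto)
      with False show ?thesis by simp
    qed
  qed
  then have "collision k i z + collision k (opp i) z = 0"
    using i z by (simp add: hierarchy opp_le distrib_left sum.distrib del: One_nat_def)
  then show ?thesis
    using sum_f_quad_odd[OF k sym z] by (simp add: collision_sum i)
qed

lemma order_even_first:
  assumes k: "even k" and sym: "\<And>m. m < k \<Longrightarrow> symmetric m" and i: "i \<le> 8" and z: "z \<in> D"
  shows "f k i z - f k (opp i) z = 6 * weight i * (vel i \<bullet> mom f k z)"
proof -
  have "(\<Sum>n=1..k. F (k - n) z * (str 1 n i z - str 1 n (opp i) z)) = 0"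
  proof (intro sum.neutral ballI)
    fix n assume n: "n \<in> {1..k}"
    consider "even n" | "n = 1" | "odd n" "2 \<le> n" using n by fastforce
    then show "F (k - n) z * (str 1 n i z - str 1 n (opp i) z) = 0"
    proof cases
      case 1
      have "str 1 n (opp i) z = (-1) ^ n * str 1 n i z"
        by (rule streaming_symmetric) (use n sym i z in auto)
      with 1 show ?thesis by simp
    next
      \<comment> \<open>Here \<open>F (k - 1) z\<close> contains the strain of the open order
        \<open>k\<close>, so the streaming factor has to vanish instead.\<close>
      case 2
      then show ?thesis using i z by (simp only: streaming_1_1 opp_le diff_self mult_zero_right)
    next
      case 3
      have "F (k - n) z = 0"
        by (rule F_odd_eq_0) (use 3 n k sym z in auto)
      then show ?thesis by simp
    qed
  qed
  then have "collision k i z - collision k (opp i) z = 0"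
    using i z by (simp add: hierarchy opp_le right_diff_distrib sum_subtractf del: One_nat_def)
  then show ?thesis
    by (simp add: collision_diff i)
qed

text \<open>\<open>order_odd_first\<close> gives no odd part. At order 1 there is no streaming, so
  \<open>f 1\<close> is a local equilibrium.\<close>

lemma order_1_first:
  assumes i: "i \<le> 8" and z: "z \<in> D"
  shows "f 1 i z - f 1 (opp i) z = 6 * weight i * (vel i \<bullet> mom f 1 z)"
proof -
  have "collision 1 j z = 0" if "j \<le> 8" for j
    using hierarchy[OF that z, of 1] streaming_1_1[OF that z] by simp
  then show ?thesis
    using collision_diff[OF i, of 1 z] i by (simp add: opp_le)
qed

lemma next_order_even_first:
  assumes k: "even k" "2 \<le> k" and sym: "\<And>m. m < k \<Longrightarrow> symmetric m" and i: "i \<le> 8" and z: "z \<in> D"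
  shows "f (k + 1) i z + f (k + 1) (opp i) z
      = 2 * weight i * rho f (k + 1) z + 4 * f_quad i (mom f 1 z) (mom f k z)
        - weight i * ((9 * \<mu> (contract (strain T f 1 z) (strain T f 1 z)) + 3/2)
              * contract (strain T f k z) (vel_tensor i)
            + 18 * dir_deriv {0..} 1 \<mu> (contract (strain T f 1 z) (strain T f 1 z))
              * contract (strain T f 1 z) (strain T f k z) * contract (strain T f 1 z) (vel_tensor i))"
proof -
  \<comment> \<open>The survivors: \<open>n = 2\<close>, where \<open>F (k - 1)\<close> contains the
    open strain of order \<open>k\<close>, and \<open>n = k + 1\<close>, where the streaming
    contains \<open>f k\<close>.\<close>
  have "(\<Sum>n=1..k + 1. F (k + 1 - n) z * (str 1 n i z + str 1 n (opp i) z))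
      = (\<Sum>n\<in>{2, k + 1}. F (k + 1 - n) z * (str 1 n i z + str 1 n (opp i) z))"
  proof (intro sum.mono_neutral_right ballI)
    fix n assume n: "n \<in> {1..k + 1} - {2, k + 1}"
    show "F (k + 1 - n) z * (str 1 n i z + str 1 n (opp i) z) = 0"
    proof (cases "even n")
      case True
      then have "4 \<le> n" using n by (auto elim!: evenE)
      have "F (k + 1 - n) z = 0"
        by (rule F_odd_eq_0) (use True n k sym z \<open>4 \<le> n\<close> in auto)
      then show ?thesis by simp
    next
      case False
      have "str 1 n (opp i) z = (-1) ^ n * str 1 n i z"
        by (rule streaming_symmetric) (use n sym i z in auto)
      with False show ?thesis by simp
    qed
  qed (use k in auto)
  also have "\<dots> = F (k - 1) z * (str 1 2 i z + str 1 2 (opp i) z)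
      + F 0 z * (str 1 (Suc k) i z + str 1 (Suc k) (opp i) z)"
    using k by (simp add: numeral_2_eq_2)
  also have "str 1 2 i z + str 1 2 (opp i) z = 3 * weight i * contract (strain T f 1 z) (vel_tensor i)"
    using advect_opp_sum_mom[OF order_1_first[OF i] i z] i z by (simp only: streaming_1_2 opp_le)
  also have "str 1 (Suc k) i z + str 1 (Suc k) (opp i) z = 3 * weight i * contract (strain T f k z) (vel_tensor i)"
  proof -
    have "str 2 (Suc k) (opp i) z = (-1) ^ Suc k * str 2 (Suc k) i z"
      by (rule streaming_symmetric) (use sym i z in auto)
    then show ?thesis
      using advect_opp_sum_mom[OF order_even_first[OF k(1) sym i] i z] k
      by (simp add: streaming_1_Suc[unfolded One_nat_def])
  qed
  also have "(\<Sum>n=1..k + 1. F (k + 1 - n) z * (str 1 n i z + str 1 n (opp i) z))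
      = collision (k + 1) i z + collision (k + 1) (opp i) z"
    using i z by (simp only: hierarchy opp_le distrib_left sum.distrib)
  finally have "- (f (k + 1) i z + f (k + 1) (opp i) z) + 2 * weight i * rho f (k + 1) z
      + 2 * (2 * f_quad i (mom f 1 z) (mom f k z))
    = F (k - 1) z * (3 * weight i * contract (strain T f 1 z) (vel_tensor i))
      + F 0 z * (3 * weight i * contract (strain T f k z) (vel_tensor i))"
    by (simp only: collision_sum[OF i] sum_f_quad_next[OF k sym z])
  moreover have "F (k - 1) z = 6 * dir_deriv {0..} 1 \<mu> (contract (strain T f 1 z) (strain T f 1 z))
      * contract (strain T f 1 z) (strain T f k z)"
    using k by (simp add: F_odd mu_series_top[OF k sym z, unfolded One_nat_def])
  ultimately show ?thesis
    by (simp only: F_0) (simp add: algebra_simps)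
qed

end

section \<open>Second collision term: constant relaxation time\<close>

locale second_model = lattice_model +
  fixes \<tau> :: real
  assumes tau_pos: "0 < \<tau>" and solves: "solves_second_model \<mu> \<tau> T f"
begin

abbreviation "A \<equiv> A_coeff \<mu> \<tau> T f"

definition viscous_stress :: "nat \<Rightarrow> nat \<Rightarrow> (real^2) \<times> real \<Rightarrow> real"
  where "viscous_stress k i z = (\<Sum>b<k. A (k - 1 - b) z * contract (strain T f b z) (vel_tensor i))"

lemma hierarchy:
  assumes "i \<le> 8" "z \<in> D"
  shows "\<tau> * str 1 k i z = collision k i z + weight i * viscous_stress k i z"
proof -
  have "\<tau> * str 1 k i z = collision k i z
      + (\<Sum>b<k. weight i * A (k - 1 - b) z * contract (strain T f b z) (vel_tensor i))"
    using solves assms unfolding solves_second_model_def sum_antidiagonal_Suc sum_antidiagonal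
    by (simp add: collision_def streaming_def)
  then show ?thesis
    by (simp add: viscous_stress_def sum_distrib_left mult.assoc)
qed

lemma viscous_stress_opp: "i \<le> 8 \<Longrightarrow> viscous_stress k (opp i) z = viscous_stress k i z"
  by (simp add: viscous_stress_def vel_tensor_opp)

lemma A_0: "A 0 z = 3/2 * (\<tau> - 1/2) - 9/2 * \<mu> (contract (strain T f 1 z) (strain T f 1 z))"
  by (simp add: A_coeff_def mu_series_nth_0)

lemma A_odd: "odd N \<Longrightarrow> A N z = - 9/2 * fps_nth (mu_series \<mu> T f z) N"
  using odd_pos[of N] by (simp add: A_coeff_def)

lemma A_odd_eq_0: "\<lbrakk>odd N; \<And>m. m \<le> Suc N \<Longrightarrow> symmetric m; z \<in> D\<rbrakk> \<Longrightarrow> A N z = 0"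
  by (simp add: A_odd mu_series_odd_eq_0)

lemma sum_viscous_stress:
  "(\<Sum>i\<le>8. weight i * viscous_stress k i z) = (\<Sum>b<k. A (k - 1 - b) z * (2/3 * divergence b z))"
proof -
  have "(\<Sum>i\<le>8. weight i * viscous_stress k i z)
      = (\<Sum>b<k. A (k - 1 - b) z * (\<Sum>i\<le>8. weight i * contract (strain T f b z) (vel_tensor i)))"
    by (simp add: viscous_stress_def sum_distrib_left sum.swap[of _ "{..8}"] mult.left_commute)
  then show ?thesis
    by (simp add: sum_weight_tensor trace_strain)
qed

lemma momentum_balance_all:
  assumes z: "z \<in> D"
  shows "(\<Sum>i\<le>8. vel i $ a * str 1 n i z) = 0"
proof -
  have "\<tau> * (\<Sum>i\<le>8. vel i $ a * str 1 n i z) = (\<Sum>i\<le>8. vel i $ a * (\<tau> * str 1 n i z))"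
    by (simp add: sum_distrib_left mult.left_commute)
  also have "\<dots> = (\<Sum>i\<le>8. vel i $ a * collision n i z + vel i $ a * (weight i * viscous_stress n i z))"
    using z by (intro sum.cong refl) (simp add: hierarchy[unfolded One_nat_def] distrib_left)
  also have "\<dots> = 0"
  proof -
    have "(\<Sum>i\<le>8. vel i $ a * (weight i * viscous_stress n i z)) = 0"
      by (rule sum_odd_eq_0) (simp add: vel_opp weight_opp viscous_stress_opp)
    then show ?thesis
      by (simp add: sum.distrib sum_vel_collision)
  qed
  finally show ?thesis using tau_pos by simp
qed

lemma mass_balance_all:
  assumes z: "z \<in> D"
  shows "\<tau> * (\<Sum>i\<le>8. str 1 n i z) = (\<Sum>b<n. A (n - 1 - b) z * (2/3 * divergence b z))"
proof -
  have "\<tau> * (\<Sum>i\<le>8. str 1 n i z) = (\<Sum>i\<le>8. collision n i z + weight i * viscous_stress n i z)"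
    unfolding sum_distrib_left using z by (intro sum.cong hierarchy) auto
  then show ?thesis
    by (simp add: sum.distrib sum_collision sum_viscous_stress)
qed

text \<open>The factor is 1 - (3 \<mu> + 1/2) / \<tau>, which is below 1 because \<mu> is
  nonnegative.\<close>

lemma trace_factor:
  assumes "\<tau> * s = A 0 z * (2/3 * d)"
  shows "\<exists>\<kappa><1. s = \<kappa> * d"
proof (intro exI conjI)
  show "A 0 z * (2/3) / \<tau> < 1"
    using tau_pos mu_nonneg'[of z] by (simp add: A_0 field_simps)
  show "s = A 0 z * (2/3) / \<tau> * d"
    using tau_pos assms by (simp add: field_simps)
qed

lemma mass_balance_2_second:
  assumes z: "z \<in> D"
  shows "\<exists>\<kappa><1. (\<Sum>i\<le>8. str 1 2 i z) = \<kappa> * divergence 1 z"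
proof (rule trace_factor)
  show "\<tau> * (\<Sum>i\<le>8. str 1 2 i z) = A 0 z * (2/3 * divergence 1 z)"
    using mass_balance_all[OF z, of 2] divergence_symmetric[OF symmetric_0 _ z]
    by (simp add: numeral_2_eq_2)
qed

lemma mass_balance_second:
  assumes k: "odd k" and sym: "\<And>m. m < k \<Longrightarrow> symmetric m" and div: "divergence 1 z = 0" and z: "z \<in> D"
  shows "\<exists>\<kappa><1. (\<Sum>i\<le>8. str 1 (k + 2) i z) = \<kappa> * divergence (k + 1) z"
proof (rule trace_factor)
  have "(\<Sum>b<k + 2. A (k + 2 - 1 - b) z * (2/3 * divergence b z))
      = (\<Sum>b\<in>{k + 1}. A (k + 2 - 1 - b) z * (2/3 * divergence b z))"
  proof (intro sum.mono_neutral_right ballI)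
    fix b assume b: "b \<in> {..<k + 2} - {k + 1}"
    have "even b \<or> b = 1 \<or> odd b \<and> 3 \<le> b" by presburger
    then consider "even b" | "b = 1" | "odd b" "3 \<le> b" by blast
    then show "A (k + 2 - 1 - b) z * (2/3 * divergence b z) = 0"
    proof cases
      case 1
      then have "b < k" using b k by (auto simp: less_Suc_eq)
      then show ?thesis using 1 sym z by (simp add: divergence_symmetric)
    next
      case 3
      have "A (k + 2 - 1 - b) z = 0"
        by (rule A_odd_eq_0) (use 3 b k sym z in auto)
      then show ?thesis by simp
    \<comment> \<open>The case \<open>b = 1\<close>: \<open>A k z\<close> contains the strain of
      order \<open>k + 1\<close>, whose parity is open, so here the leading divergence has to
      vanish.\<close>
    qed (use div in simp)
  qed auto
  then show "\<tau> * (\<Sum>i\<le>8. str 1 (k + 2) i z) = A 0 z * (2/3 * divergence (k + 1) z)"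
    using mass_balance_all[OF z, of "k + 2"] by simp
qed

lemma order_odd_second:
  assumes k: "odd k" and sym: "\<And>m. m < k \<Longrightarrow> symmetric m" and i: "i \<le> 8" and z: "z \<in> D"
  shows "f k i z + f k (opp i) z = 2 * weight i * rho f k z"
proof -
  have "viscous_stress k i z = 0"
    unfolding viscous_stress_def
  proof (intro sum.neutral ballI)
    fix b assume b: "b \<in> {..<k}"
    show "A (k - 1 - b) z * contract (strain T f b z) (vel_tensor i) = 0"
    proof (cases "even b")
      case True
      then show ?thesis using b sym z by (simp add: strain_symmetric contract_def)
    next
      case False
      have "A (k - 1 - b) z = 0"
        by (rule A_odd_eq_0) (use False b k sym z in \<open>auto elim!: oddE\<close>)
      then show ?thesis by simp
    qed
  qed
  moreover have "str 1 k (opp i) z = (-1) ^ k * str 1 k i z"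
    by (rule streaming_symmetric) (use sym i z in auto)
  ultimately have "collision k i z + collision k (opp i) z = 0"
    using hierarchy[OF i z, of k] hierarchy[OF opp_le[OF i] z, of k] k i
    by (simp add: viscous_stress_opp)
  then show ?thesis
    using sum_f_quad_odd[OF k sym z] by (simp add: collision_sum i)
qed

text \<open>The additional stress is even in the direction whatever the parity of \<open>A\<close>,
  so it drops out of the difference.\<close>

lemma order_even_second:
  assumes k: "even k" and sym: "\<And>m. m < k \<Longrightarrow> symmetric m" and i: "i \<le> 8" and z: "z \<in> D"
  shows "f k i z - f k (opp i) z = 6 * weight i * (vel i \<bullet> mom f k z)"
proof -
  have "str 1 k (opp i) z = (-1) ^ k * str 1 k i z"
    by (rule streaming_symmetric) (use sym i z in auto)
  then have "collision k i z - collision k (opp i) z = 0"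
    using hierarchy[OF i z, of k] hierarchy[OF opp_le[OF i] z, of k] k i
    by (simp add: viscous_stress_opp weight_opp)
  then show ?thesis
    by (simp add: collision_diff i)
qed

text \<open>\<tau> cancels: streaming gives 3 \<tau>, the constant part of \<open>A 0\<close> takes
  away 3 (\<tau> - 1/2), and 3/2 remains. This is why A has these constants, and why both models
  yield the same stress.\<close>

lemma next_order_even_second:
  assumes k: "even k" "2 \<le> k" and sym: "\<And>m. m < k \<Longrightarrow> symmetric m" and i: "i \<le> 8" and z: "z \<in> D"
  shows "f (k + 1) i z + f (k + 1) (opp i) z
      = 2 * weight i * rho f (k + 1) z + 4 * f_quad i (mom f 1 z) (mom f k z)
        - weight i * ((9 * \<mu> (contract (strain T f 1 z) (strain T f 1 z)) + 3/2)
              * contract (strain T f k z) (vel_tensor i)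
            + 18 * dir_deriv {0..} 1 \<mu> (contract (strain T f 1 z) (strain T f 1 z))
              * contract (strain T f 1 z) (strain T f k z) * contract (strain T f 1 z) (vel_tensor i))"
proof -
  let ?C = "\<lambda>b. contract (strain T f b z) (vel_tensor i)"
  have "viscous_stress (k + 1) i z = (\<Sum>b\<in>{1, k}. A (k + 1 - 1 - b) z * ?C b)"
    unfolding viscous_stress_def
  proof (intro sum.mono_neutral_right ballI)
    fix b assume b: "b \<in> {..<k + 1} - {1, k}"
    show "A (k + 1 - 1 - b) z * ?C b = 0"
    proof (cases "even b")
      case True
      then show ?thesis using b sym z by (simp add: strain_symmetric contract_def)
    next
      case False
      then have "3 \<le> b" using b by (auto elim!: oddE)
      have "A (k + 1 - 1 - b) z = 0"
        by (rule A_odd_eq_0) (use False b k sym z \<open>3 \<le> b\<close> in auto)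
      then show ?thesis by simp
    qed
  qed (use k in auto)
  also have "\<dots> = A (k - 1) z * ?C 1 + A 0 z * ?C k"
    using k by simp
  finally have stress: "viscous_stress (k + 1) i z = A (k - 1) z * ?C 1 + A 0 z * ?C k" .
  have pair: "str 1 (k + 1) i z + str 1 (k + 1) (opp i) z = 3 * weight i * ?C k"
  proof -
    have "str 2 (Suc k) (opp i) z = (-1) ^ Suc k * str 2 (Suc k) i z"
      by (rule streaming_symmetric) (use sym i z in auto)
    then show ?thesis
      using advect_opp_sum_mom[OF order_even_second[OF k(1) sym i] i z] k
      by (simp add: streaming_1_Suc[unfolded One_nat_def])
  qed
  have "\<tau> * (str 1 (k + 1) i z + str 1 (k + 1) (opp i) z)
      = (collision (k + 1) i z + collision (k + 1) (opp i) z) + 2 * weight i * viscous_stress (k + 1) i z"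
    using hierarchy[OF i z, of "k + 1"] hierarchy[OF opp_le[OF i] z, of "k + 1"] i
    by (simp add: viscous_stress_opp weight_opp distrib_left)
  then have "\<tau> * (3 * weight i * ?C k)
      = - (f (k + 1) i z + f (k + 1) (opp i) z) + 2 * weight i * rho f (k + 1) z
        + 2 * (2 * f_quad i (mom f 1 z) (mom f k z))
        + 2 * weight i * (A (k - 1) z * ?C 1 + A 0 z * ?C k)"
    by (simp only: pair collision_sum[OF i] sum_f_quad_next[OF k sym z] stress)
  moreover have "A (k - 1) z = - 9 * dir_deriv {0..} 1 \<mu> (contract (strain T f 1 z) (strain T f 1 z))
      * contract (strain T f 1 z) (strain T f k z)"
    using k by (simp add: A_odd mu_series_top[OF k sym z, unfolded One_nat_def])
  ultimately show ?thesis
    by (simp only: A_0) (simp add: field_simps)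
qed

end

theorem theorem1:
  fixes \<mu> :: "real \<Rightarrow> real" and T \<tau> :: real and L :: "real^2"
    and f :: "nat \<Rightarrow> nat \<Rightarrow> (real^2) \<times> real \<Rightarrow> real"
  assumes mu_smooth: "smooth_on {0..} \<mu>"
    and mu_nonneg: "\<And>I. I \<ge> 0 \<Longrightarrow> \<mu> I \<ge> 0"
    and mu_cond: "\<And>I. I \<ge> 0 \<Longrightarrow> \<mu> I + 2 * min (dir_deriv {0..} 1 \<mu> I) 0 * I \<ge> 0"
    and T_pos: "T > 0"
    and period_pos: "\<And>a. L $ a > 0"
    and f_smooth: "\<And>n i. i \<le> 8 \<Longrightarrow> smooth_on (slab T) (f n i)"
    and f_periodic: "\<And>n i. i \<le> 8 \<Longrightarrow> periodic_in_space T L (f n i)"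
    and f_zero: "\<And>i z. i \<le> 8 \<Longrightarrow> z \<in> slab T \<Longrightarrow> f 0 i z = weight i"
    and solves: "solves_first_model \<mu> T f \<or> (\<tau> > 0 \<and> solves_second_model \<mu> \<tau> T f)"
    and init_rho: "\<And>k x. rho f (2 * k + 1) (x, 0) = 0"
    and init_mom: "\<And>k x. mom f (2 * k) (x, 0) = 0"
  shows "\<forall>k. \<forall>i\<le>8. \<forall>z\<in>slab T. f k i z = (-1) ^ k * f k (opp i) z"
proof -
  interpret lattice_model T L f \<mu>
    by unfold_locales fact+
  have "lattice_hydrodynamics T L f \<mu>"
    using solves
  proof
    assume "solves_first_model \<mu> T f"
    then interpret first_model T L f \<mu>
      by unfold_locales
    show ?thesis
    proof (unfold_locales, goal_cases)
      case (1 I)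
      then show ?case by (rule mu_cond)
    next
      case (7 z)
      \<comment> \<open>In the first model the streamed mass vanishes at every positive order, so
        \<kappa> = 0.\<close>
      then show ?case by (intro exI[of _ 0]) (simp add: mass_balance_all[unfolded One_nat_def])
    next
      case (8 k z)
      then show ?case by (intro exI[of _ 0]) (simp add: mass_balance_all[unfolded One_nat_def])
    qed (fact init_rho init_mom order_odd_first order_even_first momentum_balance_all next_order_even_first)+
  next
    assume "\<tau> > 0 \<and> solves_second_model \<mu> \<tau> T f"
    then interpret second_model T L f \<mu> \<tau>
      by unfold_locales auto
    show ?thesis
      by unfold_locales (fact mu_cond init_rho init_mom order_odd_second order_even_second
          momentum_balance_all mass_balance_2_second mass_balance_second next_order_even_second)+
  qed
  then interpret lattice_hydrodynamics T L f \<mu> .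
  show ?thesis
    using symmetricD[OF all_symmetric] by (simp flip: mult.assoc power_mult_distrib)
qed

end
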